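(* Every system of set equations $\Sigma$ has a symbolic solution, and a symbolic solution can be computed from $\Sigma$ in time polynomial in the size of $\Sigma$.
   Context: Fix a universe set $\mathcal{U}$ and an infinite supply of variables. An equation is an expression ${\it lhs}={\it rhs}$ where ${\it lhs}$ and ${\it rhs}$ are finite sets of variables. A system of equations $\Sigma$ consists of two disjoint finite sets $L$ and $R$ of variables and a finite set of equations such that every variable in the left-hand side of an equation lies in $L$ and every variable in a right-hand side lies in $R$. A substitution on a set $S$ of variables is a map from $S$ to subsets of $\mathcal{U}$; it is proper if distinct variables are mapped to disjoint sets. A valuation of $\Sigma$ is a pair $(f_L,f_R)$ of a proper substitution $f_L$ on $L$ and a proper substitution $f_R$ on $R$; it is a solution of $\Sigma$ if for every equation $a_1\ldots a_m=b_1\ldots b_n$ of $\Sigma$ (i.e. $\{a_1,\ldots,a_m\}=\{b_1,\ldots,b_n\}$ as an equation), $f_L(a_1)\cup\cdots\cup f_L(a_m)=f_R(b_1)\cup\cdots\cup f_R(b_n)$. A symbolic valuation of $\Sigma$ consists of a new finite set $V$ of variables and a map $g$ from $L\cup R$ to subsets of $V$; for a proper substitution $h$ on $V$ define $h_L(a)=\bigcup\{h(c)\mid c\in g(a)\}$ for $a\in L$ and $h_R(b)=\bigcup\{h(c)\mid c\in g(b)\}$ for $b\in R$. A symbolic valuation is a symbolic solution of $\Sigma$ if for every proper substitution $h$ on $V$ the pair $(h_L,h_R)$ is a solution of $\Sigma$, and conversely every solution of $\Sigma$ equals $(h_L,h_R)$ for some proper substitution $h$ on $V$. *)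

theory Defs
  imports Main "HOL-Library.Disjoint_Sets" "HOL-Computational_Algebra.Polynomial"
begin

section \<open>Systems of set equations\<close>

record 'v system =
  left_vars :: "'v set"
  right_vars :: "'v set"
  equations :: "('v set \<times> 'v set) set"

definition wf_system :: "'v system \<Rightarrow> bool" where
  "wf_system \<Sigma> \<longleftrightarrow>
     finite (left_vars \<Sigma>) \<and> finite (right_vars \<Sigma>) \<and> left_vars \<Sigma> \<inter> right_vars \<Sigma> = {} \<and>
     finite (equations \<Sigma>) \<and>
     (\<forall>(l, r) \<in> equations \<Sigma>. l \<subseteq> left_vars \<Sigma> \<and> r \<subseteq> right_vars \<Sigma>)"

text \<open>
  A substitution on \<open>S\<close> is represented by a total function of which only the values on \<open>S\<close>
  matter; accordingly, equality of valuations is equality on the variables of the system.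
\<close>

definition proper_subst :: "'u set \<Rightarrow> 'v set \<Rightarrow> ('v \<Rightarrow> 'u set) \<Rightarrow> bool" where
  "proper_subst U S f \<longleftrightarrow> (\<forall>x\<in>S. f x \<subseteq> U) \<and> disjoint_family_on f S"

definition valuation :: "'u set \<Rightarrow> 'v system \<Rightarrow> ('v \<Rightarrow> 'u set) \<Rightarrow> ('v \<Rightarrow> 'u set) \<Rightarrow> bool" where
  "valuation U \<Sigma> fL fR \<longleftrightarrow>
     proper_subst U (left_vars \<Sigma>) fL \<and> proper_subst U (right_vars \<Sigma>) fR"

definition solution :: "'u set \<Rightarrow> 'v system \<Rightarrow> ('v \<Rightarrow> 'u set) \<Rightarrow> ('v \<Rightarrow> 'u set) \<Rightarrow> bool" where
  "solution U \<Sigma> fL fR \<longleftrightarrow>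
     valuation U \<Sigma> fL fR \<and> (\<forall>(l, r) \<in> equations \<Sigma>. (\<Union>a\<in>l. fL a) = (\<Union>b\<in>r. fR b))"

definition symbolic_valuation :: "'v system \<Rightarrow> 'v set \<Rightarrow> ('v \<Rightarrow> 'v set) \<Rightarrow> bool" where
  "symbolic_valuation \<Sigma> V g \<longleftrightarrow>
     finite V \<and> V \<inter> (left_vars \<Sigma> \<union> right_vars \<Sigma>) = {} \<and>
     (\<forall>x \<in> left_vars \<Sigma> \<union> right_vars \<Sigma>. g x \<subseteq> V)"

definition induced :: "('v \<Rightarrow> 'v set) \<Rightarrow> ('v \<Rightarrow> 'u set) \<Rightarrow> 'v \<Rightarrow> 'u set" where
  "induced g h x = (\<Union>c \<in> g x. h c)"

definition symbolic_solution :: "'u set \<Rightarrow> 'v system \<Rightarrow> 'v set \<Rightarrow> ('v \<Rightarrow> 'v set) \<Rightarrow> bool" where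
  "symbolic_solution U \<Sigma> V g \<longleftrightarrow>
     symbolic_valuation \<Sigma> V g \<and>
     (\<forall>h. proper_subst U V h \<longrightarrow> solution U \<Sigma> (induced g h) (induced g h)) \<and>
     (\<forall>fL fR. solution U \<Sigma> fL fR \<longrightarrow>
        (\<exists>h. proper_subst U V h \<and>
             (\<forall>a \<in> left_vars \<Sigma>. fL a = induced g h a) \<and>
             (\<forall>b \<in> right_vars \<Sigma>. fR b = induced g h b)))"


section \<open>Deterministic multi-tape Turing machines\<close>

text \<open>
  The tape alphabet is \<open>'a option\<close>, with \<open>None\<close> as the blank; tapes are infinite in both
  directions. The states of \<open>M\<close> are \<open>0, \<dots>, states M\<close>, where \<open>0\<close> is the initial state and
  \<open>states M\<close> the only halting state. Tape \<open>0\<close> holds the input and tape \<open>1\<close> the output.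
\<close>

datatype move = Go_Left | Stay | Go_Right

record 'a tm =
  tapes :: nat
  states :: nat
  delta :: "nat \<Rightarrow> 'a option list \<Rightarrow> nat \<times> ('a option \<times> move) list"

definition wf_tm :: "'a::finite tm \<Rightarrow> bool" where
  "wf_tm M \<longleftrightarrow> 2 \<le> tapes M \<and>
     (\<forall>q < states M. \<forall>xs. length xs = tapes M \<longrightarrow>
        fst (delta M q xs) \<le> states M \<and> length (snd (delta M q xs)) = tapes M)"

type_synonym 'a tape = "(int \<Rightarrow> 'a option) \<times> int"

type_synonym 'a config = "nat \<times> 'a tape list"

fun read_tape :: "'a tape \<Rightarrow> 'a option" where
  "read_tape (f, i) = f i"

fun offset :: "move \<Rightarrow> int" where
  "offset Go_Left = -1"
| "offset Stay = 0"
| "offset Go_Right = 1"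

fun act :: "'a option \<times> move \<Rightarrow> 'a tape \<Rightarrow> 'a tape" where
  "act (x, m) (f, i) = (f(i := x), i + offset m)"

fun step :: "'a tm \<Rightarrow> 'a config \<Rightarrow> 'a config" where
  "step M (q, ts) =
     (if q < states M
      then (case delta M q (map read_tape ts) of (q', as) \<Rightarrow> (q', map2 act as ts))
      else (q, ts))"

definition word_on_tape :: "'a list \<Rightarrow> int \<Rightarrow> 'a option" where
  "word_on_tape w i = (if 0 \<le> i \<and> i < int (length w) then Some (w ! nat i) else None)"

definition init_config :: "'a tm \<Rightarrow> 'a list \<Rightarrow> 'a config" where
  "init_config M w =
     (0, map (\<lambda>j. (word_on_tape (if j = 0 then w else []), 0)) [0..<tapes M])"

definition computes_within :: "'a tm \<Rightarrow> 'a list \<Rightarrow> 'a list \<Rightarrow> nat \<Rightarrow> bool" where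
  "computes_within M w v t \<longleftrightarrow>
     (\<exists>n\<le>t. case (step M ^^ n) (init_config M w) of (q, ts) \<Rightarrow>
        q = states M \<and> fst (ts ! 1) = word_on_tape v)"


section \<open>Encoding of systems and symbolic valuations as words\<close>

datatype letter = Bit bool | Comma | Semicolon

instance letter :: finite
proof
  have "(UNIV :: letter set) \<subseteq> range Bit \<union> {Comma, Semicolon}"
    using letter.exhaust by blast
  then show "finite (UNIV :: letter set)"
    by (rule finite_subset) simp
qed

text \<open>
  For the purpose of computation the variables are the binary words. Finite sets are written
  as lists in an arbitrary order, possibly with repetitions, so a system has many encodings.
\<close>

type_synonym var = "bool list"

definition enc_var :: "var \<Rightarrow> letter list" where
  "enc_var x = map Bit x @ [Comma]"

definition enc_vars :: "var list \<Rightarrow> letter list" where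
  "enc_vars xs = concat (map enc_var xs) @ [Semicolon]"

definition encodes_system :: "letter list \<Rightarrow> var system \<Rightarrow> bool" where
  "encodes_system w \<Sigma> \<longleftrightarrow>
     (\<exists>ls rs es.
        w = enc_vars ls @ enc_vars rs @ concat (map (\<lambda>(l, r). enc_vars l @ enc_vars r) es) \<and>
        left_vars \<Sigma> = set ls \<and> right_vars \<Sigma> = set rs \<and>
        equations \<Sigma> = (\<lambda>(l, r). (set l, set r)) ` set es)"

text \<open>
  A symbolic valuation \<open>(V, g)\<close> is written as a list of \<open>V\<close> followed by a table of \<open>g\<close>
  with entries for exactly the variables of the system.
\<close>

definition encodes_symbolic_valuation ::
    "var system \<Rightarrow> letter list \<Rightarrow> var set \<Rightarrow> (var \<Rightarrow> var set) \<Rightarrow> bool" where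
  "encodes_symbolic_valuation \<Sigma> v V g \<longleftrightarrow>
     (\<exists>vs gs.
        v = enc_vars vs @ concat (map (\<lambda>(x, ys). enc_var x @ enc_vars ys) gs) \<and>
        V = set vs \<and> fst ` set gs = left_vars \<Sigma> \<union> right_vars \<Sigma> \<and>
        (\<forall>(x, ys) \<in> set gs. g x = set ys))"

end

theory Submission
  imports Defs
begin

text \<open>
  A point of the universe lies in at most one left and at most one right variable, so a valuation
  assigns to each point a pair of optional variables. It is a solution iff every such pair
  \<open>(p, q)\<close> is compatible with the equations: \<open>p\<close> occurs in \<open>l\<close> iff \<open>q\<close> occurs in \<open>r\<close>, for each
  equation \<open>(l, r)\<close>. Hence one fresh variable per pair, with \<open>g x\<close> the variables of the compatible
  pairs that contain \<open>x\<close>, yields a symbolic solution. Variables of incompatible pairs may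
  stay in \<open>V\<close>, since no \<open>g x\<close> contains them; the machine therefore names all pairs, in the order of
  their enumeration and in unary, starting from the length of the input to ensure freshness.
\<close>

section \<open>Symbolic solutions from pairs of variables\<close>

text \<open>Properness is what keeps the construction polynomial: it leaves \<open>|L| + 1\<close>
  options for a point on the left and \<open>|R| + 1\<close> on the right, hence quadratically many
  pairs, where unrestricted sets would need exponentially many cells. \<open>None\<close> belongs to
  no side of an equation, so \<open>(None, None)\<close> is always compatible: points outside all
  variables are unconstrained. Nothing computed depends on \<open>U\<close>, so one machine serves
  every universe. The obstacle is the explicit machine with its step count. Unary names replace
  arithmetic by copying: two names differ because their lengths differ. They have quadratic length,
  there are quadratically many of them, and the table has at most linearly many entries, so the
  output stays polynomial. Configurations and running times are established together, for a small
  language whose executions match machine steps one by one.\<close>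

definition compatible :: "('v set \<times> 'v set) set \<Rightarrow> 'v option \<times> 'v option \<Rightarrow> bool" where
  "compatible E p \<longleftrightarrow> (\<forall>(l, r) \<in> E. fst p \<in> Some ` l \<longleftrightarrow> snd p \<in> Some ` r)"

lemma compatible_iff:
  "compatible E p \<longleftrightarrow> (\<forall>l r. (l, r) \<in> E \<longrightarrow> (fst p \<in> Some ` l) = (snd p \<in> Some ` r))"
  unfolding compatible_def by (rule iffI) (simp_all add: Ball_def)

text \<open>\<open>None\<close> stands for a point that lies in no variable of the respective side.\<close>

definition cell_pairs :: "'v system \<Rightarrow> ('v option \<times> 'v option) set" where
  "cell_pairs \<Sigma> = insert None (Some ` left_vars \<Sigma>) \<times> insert None (Some ` right_vars \<Sigma>)"

definition cell_of :: "'v set \<Rightarrow> ('v \<Rightarrow> 'u set) \<Rightarrow> 'u \<Rightarrow> 'v option" where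
  "cell_of S f u = (if \<exists>a\<in>S. u \<in> f a then Some (SOME a. a \<in> S \<and> u \<in> f a) else None)"

text \<open>Disjointness leaves at most one candidate, so the choice made by \<open>SOME\<close> is
  forced.\<close>

lemma cell_of_eq_Some_iff:
  assumes "disjoint_family_on f S"
  shows "cell_of S f u = Some a \<longleftrightarrow> a \<in> S \<and> u \<in> f a"
proof -
  have unique: "a = b" if "a \<in> S" "u \<in> f a" "b \<in> S" "u \<in> f b" for a b
    using assms that unfolding disjoint_family_on_def by blast
  show ?thesis
  proof (cases "\<exists>a\<in>S. u \<in> f a")
    case True
    then obtain b where b: "b \<in> S \<and> u \<in> f b" by blast
    then have "(SOME a. a \<in> S \<and> u \<in> f a) \<in> S \<and> u \<in> f (SOME a. a \<in> S \<and> u \<in> f a)"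
      by (rule someI)
    with True show ?thesis
      unfolding cell_of_def using unique by auto
  next
    case False
    then show ?thesis unfolding cell_of_def by auto
  qed
qed

lemma cell_of_in: "cell_of S f u \<in> insert None (Some ` S)"
proof (cases "\<exists>a\<in>S. u \<in> f a")
  case True
  then obtain b where b: "b \<in> S \<and> u \<in> f b" by blast
  then have "(SOME a. a \<in> S \<and> u \<in> f a) \<in> S \<and> u \<in> f (SOME a. a \<in> S \<and> u \<in> f a)"
    by (rule someI)
  with True show ?thesis by (simp add: cell_of_def)
qed (simp add: cell_of_def)

text \<open>The enumeration \<open>ps\<close> may repeat pairs, because the machine works with lists
  of variables that may contain repetitions. Fresh variables therefore belong to indices and not to
  pairs. The naming \<open>nm\<close> is left open so that the same argument covers an arbitrary
  infinite type of variables and the unary words of the machine.\<close>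

lemma symbolic_solution_pairs:
  fixes \<Sigma> :: "'v system" and nm :: "nat \<Rightarrow> 'v"
  assumes wf: "wf_system \<Sigma>"
    and ps: "set ps = cell_pairs \<Sigma>"
    and inj: "inj_on nm {..<length ps}"
    and fresh: "nm ` {..<length ps} \<inter> (left_vars \<Sigma> \<union> right_vars \<Sigma>) = {}"
    and V: "V = nm ` {..<length ps}"
    and g: "\<And>x. x \<in> left_vars \<Sigma> \<union> right_vars \<Sigma> \<Longrightarrow> g x =
      nm ` {k. k < length ps \<and> compatible (equations \<Sigma>) (ps ! k) \<and>
        (Some x = fst (ps ! k) \<or> Some x = snd (ps ! k))}"
  shows "symbolic_solution U \<Sigma> V g"
proof -
  let ?L = "left_vars \<Sigma>" and ?R = "right_vars \<Sigma>" and ?E = "equations \<Sigma>"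
  let ?n = "length ps"
  have LR: "?L \<inter> ?R = {}"
    and E: "\<And>l r. (l, r) \<in> ?E \<Longrightarrow> l \<subseteq> ?L \<and> r \<subseteq> ?R"
    using wf unfolding wf_system_def by blast+
  have fst_in: "fst (ps ! k) \<in> insert None (Some ` ?L)"
    and snd_in: "snd (ps ! k) \<in> insert None (Some ` ?R)" if "k < ?n" for k
    using nth_mem[OF that] unfolding ps cell_pairs_def mem_Times_iff by blast+
  \<comment> \<open>A left variable is no right variable, so it can only be the first component of a
    pair, and the disjunction in \<open>g\<close> collapses.\<close>
  have gL: "c \<in> g a \<longleftrightarrow> (\<exists>k<?n. c = nm k \<and> compatible ?E (ps ! k) \<and> fst (ps ! k) = Some a)"
    if "a \<in> ?L" for a c
  proof -
    have "snd (ps ! k) \<noteq> Some a" if "k < ?n" for k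
      using snd_in[OF that] \<open>a \<in> ?L\<close> LR
      by (metis disjoint_iff imageE insertE option.distinct(1) option.inject)
    moreover have "a \<in> ?L \<union> ?R" using that by blast
    ultimately show ?thesis
      unfolding g[OF \<open>a \<in> ?L \<union> ?R\<close>] image_iff Bex_def mem_Collect_eq by metis
  qed
  have gR: "c \<in> g b \<longleftrightarrow> (\<exists>k<?n. c = nm k \<and> compatible ?E (ps ! k) \<and> snd (ps ! k) = Some b)"
    if "b \<in> ?R" for b c
  proof -
    have "fst (ps ! k) \<noteq> Some b" if "k < ?n" for k
      using fst_in[OF that] \<open>b \<in> ?R\<close> LR
      by (metis disjoint_iff imageE insertE option.distinct(1) option.inject)
    moreover have "b \<in> ?L \<union> ?R" using that by blast
    ultimately show ?thesis
      unfolding g[OF \<open>b \<in> ?L \<union> ?R\<close>] image_iff Bex_def mem_Collect_eq by metis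
  qed
  have valuation: "symbolic_valuation \<Sigma> V g"
    unfolding symbolic_valuation_def using V fresh g by auto
  have sound: "solution U \<Sigma> (induced g h) (induced g h)" if h: "proper_subst U V h" for h
  proof -
    have hU: "h (nm k) \<subseteq> U" if "k < ?n" for k
      using h that V unfolding proper_subst_def by auto
    \<comment> \<open>Each point lies in \<open>h\<close> of at most one fresh variable, so it
      determines one index and thereby at most one variable on either side.\<close>
    have hD: "k = k'" if "k < ?n" "k' < ?n" "u \<in> h (nm k)" "u \<in> h (nm k')" for k k' u
    proof (rule ccontr)
      assume "k \<noteq> k'"
      with that inj have "nm k \<noteq> nm k'" by (auto simp: inj_on_def)
      moreover have "nm k \<in> V" "nm k' \<in> V" using that V by auto
      ultimately have "h (nm k) \<inter> h (nm k') = {}"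
        using h unfolding proper_subst_def disjoint_family_on_def by blast
      with that show False by blast
    qed
    have iL: "u \<in> induced g h a \<longleftrightarrow>
        (\<exists>k<?n. u \<in> h (nm k) \<and> compatible ?E (ps ! k) \<and> fst (ps ! k) = Some a)"
      if "a \<in> ?L" for a u
      unfolding induced_def UN_iff Bex_def gL[OF that] by blast
    have iR: "u \<in> induced g h b \<longleftrightarrow>
        (\<exists>k<?n. u \<in> h (nm k) \<and> compatible ?E (ps ! k) \<and> snd (ps ! k) = Some b)"
      if "b \<in> ?R" for b u
      unfolding induced_def UN_iff Bex_def gR[OF that] by blast
    have "proper_subst U ?L (induced g h)"
      unfolding proper_subst_def disjoint_family_on_def
    proof (intro conjI ballI impI)
      show "induced g h a \<subseteq> U" if "a \<in> ?L" for a
        using iL[OF that] hU by blast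
      show "induced g h a \<inter> induced g h a' = {}" if "a \<in> ?L" "a' \<in> ?L" "a \<noteq> a'" for a a'
      proof (rule equals0I)
        fix u
        assume "u \<in> induced g h a \<inter> induced g h a'"
        then have "u \<in> induced g h a" "u \<in> induced g h a'" by simp_all
        with that(3) hD show False
          unfolding iL[OF that(1)] iL[OF that(2)] by (metis option.inject)
      qed
    qed
    moreover have "proper_subst U ?R (induced g h)"
      unfolding proper_subst_def disjoint_family_on_def
    proof (intro conjI ballI impI)
      show "induced g h a \<subseteq> U" if "a \<in> ?R" for a
        using iR[OF that] hU by blast
      show "induced g h a \<inter> induced g h a' = {}" if "a \<in> ?R" "a' \<in> ?R" "a \<noteq> a'" for a a'
      proof (rule equals0I)
        fix u
        assume "u \<in> induced g h a \<inter> induced g h a'"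
        then have "u \<in> induced g h a" "u \<in> induced g h a'" by simp_all
        with that(3) hD show False
          unfolding iR[OF that(1)] iR[OF that(2)] by (metis option.inject)
      qed
    qed
    moreover have "(\<Union>a\<in>l. induced g h a) = (\<Union>b\<in>r. induced g h b)" if lr: "(l, r) \<in> ?E" for l r
    proof -
      \<comment> \<open>Only compatible indices contribute to \<open>induced g h\<close>, so this
        equivalence turns membership in the left union into membership in the right one, point by
        point.\<close>
      have comp: "fst (ps ! k) \<in> Some ` l \<longleftrightarrow> snd (ps ! k) \<in> Some ` r"
        if "compatible ?E (ps ! k)" for k
        using that lr unfolding compatible_iff by simp
      have "(\<exists>a\<in>l. u \<in> induced g h a) \<longleftrightarrow> (\<exists>a\<in>l. \<exists>k<?n. u \<in> h (nm k) \<and>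
          compatible ?E (ps ! k) \<and> fst (ps ! k) = Some a)" for u
        using E[OF lr] by (intro bex_cong refl iL) blast
      moreover have "(\<exists>b\<in>r. u \<in> induced g h b) \<longleftrightarrow> (\<exists>b\<in>r. \<exists>k<?n. u \<in> h (nm k) \<and>
          compatible ?E (ps ! k) \<and> snd (ps ! k) = Some b)" for u
        using E[OF lr] by (intro bex_cong refl iR) blast
      moreover have "(\<exists>a\<in>l. \<exists>k<?n. u \<in> h (nm k) \<and> compatible ?E (ps ! k) \<and>
          fst (ps ! k) = Some a) \<longleftrightarrow> (\<exists>b\<in>r. \<exists>k<?n. u \<in> h (nm k) \<and>
          compatible ?E (ps ! k) \<and> snd (ps ! k) = Some b)" for u
        using comp unfolding image_iff by metis
      ultimately show ?thesis by (simp add: set_eq_iff)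
    qed
    ultimately show ?thesis unfolding solution_def valuation_def by blast
  qed
  have complete: "\<exists>h. proper_subst U V h \<and> (\<forall>a\<in>?L. fL a = induced g h a) \<and>
      (\<forall>b\<in>?R. fR b = induced g h b)" if sol: "solution U \<Sigma> fL fR" for fL fR
  proof -
    have dL: "disjoint_family_on fL ?L" and dR: "disjoint_family_on fR ?R"
      and UL: "\<And>a. a \<in> ?L \<Longrightarrow> fL a \<subseteq> U" and UR: "\<And>b. b \<in> ?R \<Longrightarrow> fR b \<subseteq> U"
      using sol unfolding solution_def valuation_def proper_subst_def by simp_all
    have eqs: "(\<Union>a\<in>l. fL a) = (\<Union>b\<in>r. fR b)" if "(l, r) \<in> ?E" for l r
      using sol that unfolding solution_def by fastforce
    define ty where "ty u = (cell_of ?L fL u, cell_of ?R fR u)" for u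
    have fst_ty: "fst (ty u) = Some a \<longleftrightarrow> a \<in> ?L \<and> u \<in> fL a" for u a
      using cell_of_eq_Some_iff[OF dL] by (simp add: ty_def)
    have snd_ty: "snd (ty u) = Some b \<longleftrightarrow> b \<in> ?R \<and> u \<in> fR b" for u b
      using cell_of_eq_Some_iff[OF dR] by (simp add: ty_def)
    have "\<exists>k. k < ?n \<and> ps ! k = ty u" for u
    proof -
      have "ty u \<in> set ps"
        unfolding ps cell_pairs_def ty_def by (intro SigmaI cell_of_in)
      then show ?thesis unfolding in_set_conv_nth by blast
    qed
    \<comment> \<open>A repeated pair has several indices. All points of this type go to the chosen
      one; \<open>h\<close> will be empty at the others.\<close>
    then obtain ix where ix: "\<And>u. ix u < ?n \<and> ps ! ix u = ty u" by metis
    \<comment> \<open>An equation between two unions, read at the single point \<open>u\<close>, is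
      exactly the compatibility condition for the pair of \<open>u\<close>.\<close>
    have comp: "compatible ?E (ty u)" for u
    proof -
      have "fst (ty u) \<in> Some ` l \<longleftrightarrow> snd (ty u) \<in> Some ` r" if lr: "(l, r) \<in> ?E" for l r
      proof -
        have "fst (ty u) \<in> Some ` l \<longleftrightarrow> (\<exists>a\<in>l. fst (ty u) = Some a)"
          by blast
        also have "\<dots> \<longleftrightarrow> u \<in> (\<Union>a\<in>l. fL a)"
          unfolding fst_ty UN_iff using E[OF lr] by blast
        finally have "fst (ty u) \<in> Some ` l \<longleftrightarrow> u \<in> (\<Union>a\<in>l. fL a)" .
        moreover have "snd (ty u) \<in> Some ` r \<longleftrightarrow> (\<exists>b\<in>r. snd (ty u) = Some b)"
          by blast
        moreover have "(\<exists>b\<in>r. snd (ty u) = Some b) \<longleftrightarrow> u \<in> (\<Union>b\<in>r. fR b)"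
          unfolding snd_ty UN_iff using E[OF lr] by blast
        ultimately show ?thesis using eqs[OF lr] by simp
      qed
      then show ?thesis unfolding compatible_iff by simp
    qed
    define h where "h c = {u \<in> U. c = nm (ix u)}" for c
    have nm_ix: "nm k = nm (ix u) \<longleftrightarrow> k = ix u" if "k < ?n" for k u
      using inj that ix[of u] by (auto simp: inj_on_def)
    have "proper_subst U V h"
      unfolding proper_subst_def disjoint_family_on_def h_def by auto
    moreover have "fL a = induced g h a" if "a \<in> ?L" for a
    proof -
      have "u \<in> induced g h a \<longleftrightarrow> u \<in> U \<and> fst (ty u) = Some a" for u
      proof -
        have "u \<in> induced g h a \<longleftrightarrow> u \<in> U \<and> nm (ix u) \<in> g a"
          unfolding induced_def h_def by auto
        moreover have "nm (ix u) \<in> g a \<longleftrightarrow> fst (ty u) = Some a"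
          using gL[OF that, of "nm (ix u)"] nm_ix[of _ u] ix[of u] comp[of u] by metis
        ultimately show ?thesis by blast
      qed
      then show ?thesis using fst_ty UL[OF that] that by blast
    qed
    moreover have "fR b = induced g h b" if "b \<in> ?R" for b
    proof -
      have "u \<in> induced g h b \<longleftrightarrow> u \<in> U \<and> snd (ty u) = Some b" for u
      proof -
        have "u \<in> induced g h b \<longleftrightarrow> u \<in> U \<and> nm (ix u) \<in> g b"
          unfolding induced_def h_def by auto
        moreover have "nm (ix u) \<in> g b \<longleftrightarrow> snd (ty u) = Some b"
          using gR[OF that, of "nm (ix u)"] nm_ix[of _ u] ix[of u] comp[of u] by metis
        ultimately show ?thesis by blast
      qed
      then show ?thesis using snd_ty UR[OF that] that by blast
    qed
    ultimately show ?thesis by blast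
  qed
  show ?thesis
    unfolding symbolic_solution_def using valuation sound complete by blast
qed

lemma symbolic_solution_exists:
  fixes \<Sigma> :: "'v system"
  assumes "infinite (UNIV :: 'v set)" and wf: "wf_system \<Sigma>"
  shows "\<exists>V g. symbolic_solution U \<Sigma> V g"
proof -
  have fin: "finite (left_vars \<Sigma> \<union> right_vars \<Sigma>)"
    using wf unfolding wf_system_def by auto
  then have "infinite (UNIV - (left_vars \<Sigma> \<union> right_vars \<Sigma>))"
    using assms(1) by (rule Diff_infinite_finite)
  then obtain nm :: "nat \<Rightarrow> 'v"
    where nm: "inj nm" "range nm \<subseteq> UNIV - (left_vars \<Sigma> \<union> right_vars \<Sigma>)"
    using infinite_countable_subset by blast
  have "finite (cell_pairs \<Sigma>)" using fin unfolding cell_pairs_def by auto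
  then obtain ps where ps: "set ps = cell_pairs \<Sigma>" using finite_list by blast
  have "inj_on nm {..<length ps}" using nm(1) by (rule inj_on_subset) simp
  moreover have "nm ` {..<length ps} \<inter> (left_vars \<Sigma> \<union> right_vars \<Sigma>) = {}"
    using nm(2) by blast
  ultimately have "symbolic_solution U \<Sigma> (nm ` {..<length ps})
      (\<lambda>x. nm ` {k. k < length ps \<and> compatible (equations \<Sigma>) (ps ! k) \<and>
        (Some x = fst (ps ! k) \<or> Some x = snd (ps ! k))})"
    by (rule symbolic_solution_pairs[OF wf ps]) (rule refl)+
  then show ?thesis by blast
qed

section \<open>Structured programs for multi-tape machines\<close>

text \<open>
  \<open>Do j i f\<close> acts on tape \<open>j\<close> depending on the symbol read on tape \<open>i\<close>; the tests of \<open>When\<close>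
  and \<open>While\<close> inspect two tapes.
\<close>

datatype 'a prog =
    Do nat nat "'a option \<Rightarrow> 'a option \<times> move"
  | Seq "'a prog" "'a prog" (infixr \<open>;;\<close> 60)
  | When nat nat "'a option \<Rightarrow> 'a option \<Rightarrow> bool" "'a prog"
  | While nat nat "'a option \<Rightarrow> 'a option \<Rightarrow> bool" "'a prog"

text \<open>The last argument is the exact number of machine steps: one for each action and one for
  each test, while sequencing is free. Divergence shows as the lack of a derivation.\<close>

inductive exec :: "'a prog \<Rightarrow> (nat \<Rightarrow> 'a tape) \<Rightarrow> (nat \<Rightarrow> 'a tape) \<Rightarrow> nat \<Rightarrow> bool" where
  Do: "exec (Do j i f) s (s(j := act (f (read_tape (s i))) (s j))) 1"
| Seq: "exec p s s' m \<Longrightarrow> exec q s' s'' n \<Longrightarrow> exec (p ;; q) s s'' (m + n)"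
| When_True: "c (read_tape (s i)) (read_tape (s j)) \<Longrightarrow> exec p s s' n \<Longrightarrow>
    exec (When i j c p) s s' (Suc n)"
| When_False: "\<not> c (read_tape (s i)) (read_tape (s j)) \<Longrightarrow> exec (When i j c p) s s 1"
| While_True: "c (read_tape (s i)) (read_tape (s j)) \<Longrightarrow> exec p s s' m \<Longrightarrow>
    exec (While i j c p) s' s'' n \<Longrightarrow> exec (While i j c p) s s'' (Suc (m + n))"
| While_False: "\<not> c (read_tape (s i)) (read_tape (s j)) \<Longrightarrow> exec (While i j c p) s s 1"

primrec tapes_below :: "nat \<Rightarrow> 'a prog \<Rightarrow> bool" where
  "tapes_below K (Do j i f) \<longleftrightarrow> j < K \<and> i < K"
| "tapes_below K (p ;; q) \<longleftrightarrow> tapes_below K p \<and> tapes_below K q"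
| "tapes_below K (When i j c p) \<longleftrightarrow> i < K \<and> j < K \<and> tapes_below K p"
| "tapes_below K (While i j c p) \<longleftrightarrow> i < K \<and> j < K \<and> tapes_below K p"

primrec num_states :: "'a prog \<Rightarrow> nat" where
  "num_states (Do j i f) = 1"
| "num_states (p ;; q) = num_states p + num_states q"
| "num_states (When i j c p) = Suc (num_states p)"
| "num_states (While i j c p) = Suc (num_states p)"

definition idle :: "'a option list \<Rightarrow> ('a option \<times> move) list" where
  "idle xs = map (\<lambda>x. (x, Stay)) xs"

text \<open>In \<open>code p b e\<close> the program \<open>p\<close> occupies the states from \<open>b\<close> on and leaves to state \<open>e\<close>.\<close>

primrec code ::
    "'a prog \<Rightarrow> nat \<Rightarrow> nat \<Rightarrow> nat \<Rightarrow> 'a option list \<Rightarrow> nat \<times> ('a option \<times> move) list" where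
  "code (Do j i f) b e q xs = (e, (idle xs)[j := f (xs ! i)])"
| "code (p ;; p') b e q xs =
    (if q < b + num_states p then code p b (b + num_states p) q xs
     else code p' (b + num_states p) e q xs)"
| "code (When i j c p) b e q xs =
    (if q = b then (if c (xs ! i) (xs ! j) then Suc b else e, idle xs)
     else code p (Suc b) e q xs)"
| "code (While i j c p) b e q xs =
    (if q = b then (if c (xs ! i) (xs ! j) then Suc b else e, idle xs)
     else code p (Suc b) b q xs)"

definition compile :: "nat \<Rightarrow> 'a prog \<Rightarrow> 'a tm" where
  "compile K p = \<lparr>tapes = K, states = num_states p, delta = code p 0 (num_states p)\<rparr>"

section \<open>Correctness of the compilation into a transition function\<close>

lemma num_states_pos: "0 < num_states p"
  by (induction p) auto

text \<open>Serves the range condition of \<open>wf_tm\<close>. In a sequence the first part exits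
  to the entry of the second, which is still inside the block because every program occupies at
  least one state.\<close>

lemma fst_code_less:
  "b \<le> q \<Longrightarrow> q < b + num_states p \<Longrightarrow>
    fst (code p b e q xs) < b + num_states p \<or> fst (code p b e q xs) = e"
proof (induction p arbitrary: b e)
  case (Seq p1 p2)
  show ?case
  proof (cases "q < b + num_states p1")
    case True
    then show ?thesis
      using Seq.IH(1)[of b "b + num_states p1"] Seq.IH(2)[of "b + num_states p1" e] Seq.prems
        num_states_pos[of p2]
      by auto
  next
    case False
    then show ?thesis
      using Seq.IH(2)[of "b + num_states p1" e] Seq.prems by auto
  qed
next
  case (When i j c p)
  then show ?case using When.IH[of "Suc b" e] num_states_pos[of p] by (cases "q = b") auto
next
  case (While i j c p)
  then show ?case using While.IH[of "Suc b" b] num_states_pos[of p] by (cases "q = b") auto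
qed auto

lemma length_code: "length (snd (code p b e q xs)) = length xs"
  by (induction p arbitrary: b e) (auto simp: idle_def)

lemma wf_compile:
  assumes "2 \<le> K"
  shows "wf_tm (compile K p)"
proof -
  have "fst (code p 0 (num_states p) q xs) \<le> num_states p" if "q < num_states p" for q xs
    using fst_code_less[of 0 q p "num_states p" xs] that by linarith
  then show ?thesis
    using assms by (simp add: wf_tm_def compile_def length_code)
qed

lemma act_read: "act (read_tape t, Stay) t = t"
  by (cases t) auto

lemma idle_step:
  "map2 act (idle (map (read_tape \<circ> s) [0..<K])) (map s [0..<K]) = map s [0..<K]"
  by (rule nth_equalityI) (auto simp: idle_def act_read)

text \<open>The machine is only required to agree with \<open>code\<close> on the block of
  \<open>p\<close>. This makes the induction work, since subprograms are smaller blocks of the same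
  machine; a loop body is a block that exits to the test of its loop.\<close>

lemma exec_steps:
  fixes M :: "'a tm"
  assumes "exec p s s' n"
    and "tapes_below K p"
    and "\<And>q xs. b \<le> q \<Longrightarrow> q < b + num_states p \<Longrightarrow> length xs = K \<Longrightarrow>
      delta M q xs = code p b e q xs"
    and "b + num_states p \<le> states M"
  shows "(step M ^^ n) (b, map s [0..<K]) = (e, map s' [0..<K])"
  using assms
proof (induction arbitrary: b e rule: exec.induct)
  case (Do j i f s)
  have "map2 act ((idle (map (read_tape \<circ> s) [0..<K]))[j := f (read_tape (s i))]) (map s [0..<K])
      = map (s(j := act (f (read_tape (s i))) (s j))) [0..<K]"
    using Do.prems(1)
    by (intro nth_equalityI) (auto simp: idle_def act_read nth_list_update)
  then show ?case using Do.prems by (simp add: comp_def)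
next
  case (Seq p s s' m q s'' n)
  have "(step M ^^ m) (b, map s [0..<K]) = (b + num_states p, map s' [0..<K])"
    using Seq.prems by (intro Seq.IH(1)) auto
  moreover have "(step M ^^ n) (b + num_states p, map s' [0..<K]) = (e, map s'' [0..<K])"
    using Seq.prems by (intro Seq.IH(2)) auto
  ultimately show ?case
    \<comment> \<open>\<open>funpow_add\<close> applies the second summand first, hence the
      swap.\<close>
    by (simp add: add.commute[of m] funpow_add)
next
  case (When_True c s i j p s' n)
  have "step M (b, map s [0..<K]) = (Suc b, map s [0..<K])"
    using When_True.prems When_True.hyps(1) by (simp add: idle_step)
  moreover have "(step M ^^ n) (Suc b, map s [0..<K]) = (e, map s' [0..<K])"
    using When_True.prems by (intro When_True.IH) auto
  ultimately show ?case by (simp add: funpow_Suc_right del: funpow.simps step.simps)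
next
  case (When_False c s i j p)
  then show ?case by (simp add: idle_step)
next
  case (While_True c s i j p s' m s'' n)
  have "step M (b, map s [0..<K]) = (Suc b, map s [0..<K])"
    using While_True.prems While_True.hyps(1) by (simp add: idle_step)
  moreover have "(step M ^^ m) (Suc b, map s [0..<K]) = (b, map s' [0..<K])"
    using While_True.prems by (intro While_True.IH(1)) auto
  moreover have "(step M ^^ n) (b, map s' [0..<K]) = (e, map s'' [0..<K])"
    using While_True.prems by (intro While_True.IH(2)) auto
  ultimately show ?case
    by (simp add: add.commute[of m] funpow_add funpow_Suc_right del: funpow.simps step.simps)
next
  case (While_False c s i j p)
  then show ?case by (simp add: idle_step)
qed

section \<open>Executions with an upper bound on the time\<close>

text \<open>Exact times depend on data such as the length of a common prefix; a bound can be uniform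
  over all rounds of a loop.\<close>

definition runs :: "'a prog \<Rightarrow> (nat \<Rightarrow> 'a tape) \<Rightarrow> (nat \<Rightarrow> 'a tape) \<Rightarrow> nat \<Rightarrow> bool" where
  "runs p s s' t \<longleftrightarrow> (\<exists>n\<le>t. exec p s s' n)"

lemma computes_within_compile:
  assumes "runs p (\<lambda>j. (word_on_tape (if j = 0 then w else []), 0)) s t"
    and "tapes_below K p" "2 \<le> K" "fst (s 1) = word_on_tape v"
  shows "computes_within (compile K p) w v t"
proof -
  let ?s = "\<lambda>j. (word_on_tape (if j = 0 then w else []), 0 :: int)"
  obtain n where n: "n \<le> t" "exec p ?s s n" using assms(1) unfolding runs_def by blast
  have "(step (compile K p) ^^ n) (0, map ?s [0..<K]) = (num_states p, map s [0..<K])"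
    by (rule exec_steps[OF n(2) assms(2)]) (simp_all add: compile_def)
  moreover have "init_config (compile K p) w = (0, map ?s [0..<K])"
    by (simp add: init_config_def compile_def)
  ultimately show ?thesis
    unfolding computes_within_def using n(1) assms(3,4)
    by (intro exI[of _ n]) (simp add: compile_def)
qed

lemma runs_mono: "runs p s s' t \<Longrightarrow> t \<le> t' \<Longrightarrow> runs p s s' t'"
  unfolding runs_def using le_trans by blast

lemma runs_Do: "s' = s(j := act (f (read_tape (s i))) (s j)) \<Longrightarrow> runs (Do j i f) s s' 1"
  unfolding runs_def using exec.Do by blast

lemma runs_Seq: "runs p s s' t \<Longrightarrow> runs q s' s'' t' \<Longrightarrow> runs (p ;; q) s s'' (t + t')"
  unfolding runs_def using exec.Seq add_mono by blast

text \<open>Both branches share the final state \<open>s'\<close>, so callers can describe it by one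
  expression that reduces to \<open>s\<close> when the test fails.\<close>

lemma runs_When:
  assumes "c (read_tape (s i)) (read_tape (s j)) \<Longrightarrow> runs p s s' t"
    and "\<not> c (read_tape (s i)) (read_tape (s j)) \<Longrightarrow> s' = s"
  shows "runs (When i j c p) s s' (Suc t)"
proof (cases "c (read_tape (s i)) (read_tape (s j))")
  case True
  then obtain n where "n \<le> t" "exec p s s' n"
    using assms(1) unfolding runs_def by blast
  then show ?thesis
    unfolding runs_def using exec.When_True[of c s i j, OF True] by (metis Suc_le_mono)
next
  case False
  then show ?thesis
    unfolding runs_def using exec.When_False[of c s i j, OF False] assms(2) by auto
qed

text \<open>The arguments of \<open>\<sigma>\<close> are the items processed so far and the remaining items.\<close>

lemma runs_While_list:
  assumes "\<And>ys x zs. xs = ys @ x # zs \<Longrightarrow>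
      c (read_tape (\<sigma> ys (x # zs) i)) (read_tape (\<sigma> ys (x # zs) j))"
    and "\<And>ys x zs. xs = ys @ x # zs \<Longrightarrow> runs p (\<sigma> ys (x # zs)) (\<sigma> (ys @ [x]) zs) t"
    and "\<not> c (read_tape (\<sigma> xs [] i)) (read_tape (\<sigma> xs [] j))"
  shows "runs (While i j c p) (\<sigma> [] xs) (\<sigma> xs []) (length xs * Suc t + 1)"
proof -
  have "runs (While i j c p) (\<sigma> ys zs) (\<sigma> xs []) (length zs * Suc t + 1)"
    if "xs = ys @ zs" for ys zs
    using that
  proof (induction zs arbitrary: ys)
    case Nil
    then show ?case
      unfolding runs_def using exec.While_False[of c "\<sigma> xs []" i j, OF assms(3)] by auto
  next
    case (Cons z zs)
    obtain m n where "m \<le> t" "exec p (\<sigma> ys (z # zs)) (\<sigma> (ys @ [z]) zs) m"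
      and "n \<le> length zs * Suc t + 1" "exec (While i j c p) (\<sigma> (ys @ [z]) zs) (\<sigma> xs []) n"
      using assms(2)[OF Cons.prems] Cons.IH[of "ys @ [z]"] Cons.prems unfolding runs_def by auto
    then have "exec (While i j c p) (\<sigma> ys (z # zs)) (\<sigma> xs []) (Suc (m + n))"
      and "Suc (m + n) \<le> length (z # zs) * Suc t + 1"
      using exec.While_True[of c "\<sigma> ys (z # zs)" i j, OF assms(1)[OF Cons.prems]] by auto
    then show ?case unfolding runs_def by blast
  qed
  from this[of "[]" xs] show ?thesis by simp
qed

section \<open>Tapes as zippers\<close>

definition zip_tape :: "'a list \<Rightarrow> 'a list \<Rightarrow> 'a tape" where
  "zip_tape u v = (word_on_tape (u @ v), int (length u))"

text \<open>A head on the blank just before the word is not a \<open>zip_tape\<close>. Such a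
  position is described as \<open>shift Go_Left\<close> of one, which leftward scans need at their
  last test.\<close>

fun shift :: "move \<Rightarrow> 'a tape \<Rightarrow> 'a tape" where
  "shift m (f, i) = (f, i + offset m)"

lemma read_zip_tape [simp]:
  "read_tape (zip_tape u []) = None"
  "read_tape (zip_tape u (x # v)) = Some x"
  by (simp_all add: zip_tape_def word_on_tape_def)

lemma shift_Right_zip_tape [simp]: "shift Go_Right (zip_tape u (x # v)) = zip_tape (u @ [x]) v"
  by (simp add: zip_tape_def)

lemma shift_Left_zip_tape: "shift Go_Left (zip_tape (u @ [x]) v) = zip_tape u (x # v)"
  by (simp add: zip_tape_def)

lemma shift_Right_Left [simp]: "shift Go_Right (shift Go_Left t) = t"
  by (cases t) simp

lemma read_shift_Left_start [simp]: "read_tape (shift Go_Left (zip_tape [] v)) = None"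
  by (simp add: zip_tape_def word_on_tape_def)

lemma act_keep [simp]: "act (read_tape t, m) t = shift m t"
  by (cases t) simp

lemma word_on_tape_snoc: "word_on_tape (u @ [x]) = (word_on_tape u)(int (length u) := Some x)"
  by (auto simp: word_on_tape_def fun_eq_iff nth_append)

lemma act_append [simp]: "act (Some x, Go_Right) (zip_tape u []) = zip_tape (u @ [x]) []"
  by (simp add: zip_tape_def word_on_tape_snoc)

lemma act_erase_last: "act (None, m) (zip_tape u [x]) = shift m (zip_tape u [])"
  by (auto simp: zip_tape_def word_on_tape_snoc) (auto simp: word_on_tape_def)

text \<open>A lowered flag is a blank tape, so all flags are down in the initial
  configuration.\<close>

definition flag_tape :: "bool \<Rightarrow> letter tape" where
  "flag_tape b = zip_tape [] (if b then [Comma] else [])"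

lemma read_flag_tape [simp]: "read_tape (flag_tape b) = (if b then Some Comma else None)"
  by (simp add: flag_tape_def)

lemma act_flag_tape [simp]:
  "act (Some Comma, Stay) (flag_tape b) = flag_tape True"
  "act (None, Stay) (flag_tape b) = flag_tape False"
  by (auto simp: flag_tape_def zip_tape_def fun_eq_iff word_on_tape_def)

section \<open>Elementary programs for moving, copying and erasing\<close>

abbreviation Move :: "nat \<Rightarrow> move \<Rightarrow> 'a prog" where
  "Move i m \<equiv> Do i i (\<lambda>x. (x, m))"

abbreviation set_flag :: "nat \<Rightarrow> bool \<Rightarrow> letter prog" where
  "set_flag i b \<equiv> Do i i (\<lambda>_. (if b then Some Comma else None, Stay))"

abbreviation append_symbol :: "nat \<Rightarrow> 'a \<Rightarrow> 'a prog" where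
  "append_symbol i x \<equiv> Do i i (\<lambda>_. (Some x, Go_Right))"

lemma runs_Move: "s' = s(i := shift m (s i)) \<Longrightarrow> runs (Move i m) s s' 1"
  by (rule runs_Do) simp

text \<open>The head starts one cell to the right of the block and leaves the loop one cell to its
  left, hence the moves before and after.\<close>

definition rewind :: "('a option \<Rightarrow> bool) \<Rightarrow> nat \<Rightarrow> 'a prog" where
  "rewind P i = Move i Go_Left ;; While i i (\<lambda>x _. P x) (Move i Go_Left) ;; Move i Go_Right"

definition forward :: "('a option \<Rightarrow> bool) \<Rightarrow> nat \<Rightarrow> 'a prog" where
  "forward P i = While i i (\<lambda>x _. P x) (Move i Go_Right)"

definition transfer :: "('a option \<Rightarrow> bool) \<Rightarrow> ('a \<Rightarrow> 'a) \<Rightarrow> nat \<Rightarrow> nat \<Rightarrow> 'a prog" where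
  "transfer P f i j =
     While i i (\<lambda>x _. P x) (Do j i (\<lambda>x. (map_option f x, Go_Right)) ;; Move i Go_Right)"

text \<open>Working from right to left keeps the content a word that starts at position
  \<open>0\<close> all the time.\<close>

definition erase :: "nat \<Rightarrow> 'a prog" where
  "erase i = Move i Go_Left ;; While i i (\<lambda>x _. x \<noteq> None) (Do i i (\<lambda>_. (None, Go_Left))) ;;
     Move i Go_Right"

text \<open>The condition for a scan to halt in front of \<open>v\<close>, where the empty list
  stands for the blank after the word. Scans to the left use it with the reversed prefix.\<close>

definition stops :: "('a option \<Rightarrow> bool) \<Rightarrow> 'a list \<Rightarrow> bool" where
  "stops P v \<longleftrightarrow> \<not> P (case v of [] \<Rightarrow> None | x # _ \<Rightarrow> Some x)"

lemma stops_simps [simp]: "stops P [] \<longleftrightarrow> \<not> P None" "stops P (x # v) \<longleftrightarrow> \<not> P (Some x)"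
  by (simp_all add: stops_def)

lemma runs_rewind:
  assumes s: "s i = zip_tape (u @ x) v" and P: "\<And>y. y \<in> set x \<Longrightarrow> P (Some y)"
    and u: "stops P (rev u)" and N: "\<not> P None"
  shows "runs (rewind P i) s (s(i := zip_tape u (x @ v))) (2 * length x + 3)"
proof -
  \<comment> \<open>The loop consumes \<open>rev x\<close>. The additional
    \<open>shift Go_Left\<close> puts the head on the symbol to be tested next, possibly the blank
    before the word.\<close>
  define \<sigma> where "\<sigma> ys zs = s(i := shift Go_Left (zip_tape (u @ rev zs) (rev ys @ v)))" for ys zs
  have "runs (Move i Go_Left) s (\<sigma> [] (rev x)) 1"
    by (rule runs_Move) (simp add: \<sigma>_def s)
  moreover have "runs (While i i (\<lambda>x _. P x) (Move i Go_Left)) (\<sigma> [] (rev x)) (\<sigma> (rev x) [])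
      (length (rev x) * Suc 1 + 1)"
  proof (rule runs_While_list)
    fix ys z zs
    assume "rev x = ys @ z # zs"
    then have z: "z \<in> set x" by (metis in_set_conv_decomp set_rev)
    have eq: "shift Go_Left (zip_tape (u @ rev (z # zs)) w) = zip_tape (u @ rev zs) (z # w)" for w
      using shift_Left_zip_tape[of "u @ rev zs" z] by simp
    show "P (read_tape (\<sigma> ys (z # zs) i))"
      unfolding \<sigma>_def fun_upd_same eq using P z by simp
    show "runs (Move i Go_Left) (\<sigma> ys (z # zs)) (\<sigma> (ys @ [z]) zs) 1"
      by (rule runs_Move) (use eq in \<open>simp add: \<sigma>_def\<close>)
  next
    show "\<not> P (read_tape (\<sigma> (rev x) [] i))"
    proof (cases u rule: rev_cases)
      case Nil
      then show ?thesis using N by (simp add: \<sigma>_def)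
    next
      case (snoc u' z)
      then show ?thesis using u by (simp add: \<sigma>_def shift_Left_zip_tape)
    qed
  qed
  moreover have "runs (Move i Go_Right) (\<sigma> (rev x) []) (s(i := zip_tape u (x @ v))) 1"
    by (rule runs_Move) (simp add: \<sigma>_def)
  ultimately have "runs (rewind P i) s (s(i := zip_tape u (x @ v)))
      (1 + (length (rev x) * Suc 1 + 1 + 1))"
    unfolding rewind_def by (intro runs_Seq)
  then show ?thesis by (rule runs_mono) simp
qed

lemma runs_forward:
  assumes s: "s i = zip_tape u (x @ v)" and P: "\<And>y. y \<in> set x \<Longrightarrow> P (Some y)"
    and v: "stops P v"
  shows "runs (forward P i) s (s(i := zip_tape (u @ x) v)) (2 * length x + 1)"
proof -
  define \<sigma> where "\<sigma> ys zs = s(i := zip_tape (u @ ys) (zs @ v))" for ys zs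
  have "runs (forward P i) (\<sigma> [] x) (\<sigma> x []) (length x * Suc 1 + 1)"
    unfolding forward_def
  proof (rule runs_While_list)
    show "\<not> P (read_tape (\<sigma> x [] i))"
      using v by (cases v) (simp_all add: \<sigma>_def)
    show "runs (Move i Go_Right) (\<sigma> ys (z # zs)) (\<sigma> (ys @ [z]) zs) 1" for ys z zs
      by (rule runs_Move) (simp add: \<sigma>_def)
  qed (simp add: \<sigma>_def P)
  moreover have "\<sigma> [] x = s" using s by (auto simp: \<sigma>_def)
  ultimately have "runs (forward P i) s (\<sigma> x []) (length x * Suc 1 + 1)" by simp
  then show ?thesis unfolding \<sigma>_def append_Nil append_Nil2 by (rule runs_mono) simp
qed

lemma runs_transfer:
  assumes s: "s i = zip_tape u (x @ v)" "s j = zip_tape w []" and ij: "i \<noteq> j"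
    and P: "\<And>y. y \<in> set x \<Longrightarrow> P (Some y)" and v: "stops P v"
  shows "runs (transfer P f i j) s (s(i := zip_tape (u @ x) v, j := zip_tape (w @ map f x) []))
    (3 * length x + 1)"
proof -
  define \<sigma> where "\<sigma> ys zs =
    s(i := zip_tape (u @ ys) (zs @ v), j := zip_tape (w @ map f ys) [])" for ys zs
  have "runs (transfer P f i j) (\<sigma> [] x) (\<sigma> x []) (length x * Suc (1 + 1) + 1)"
    unfolding transfer_def
  proof (rule runs_While_list)
    show "\<not> P (read_tape (\<sigma> x [] i))"
      using v ij by (cases v) (simp_all add: \<sigma>_def)
    show "runs (Do j i (\<lambda>x. (map_option f x, Go_Right)) ;; Move i Go_Right)
        (\<sigma> ys (z # zs)) (\<sigma> (ys @ [z]) zs) (1 + 1)" for ys z zs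
    proof (rule runs_Seq)
      show "runs (Do j i (\<lambda>x. (map_option f x, Go_Right))) (\<sigma> ys (z # zs))
          ((\<sigma> ys (z # zs))(j := zip_tape (w @ map f (ys @ [z])) [])) 1"
        by (rule runs_Do) (use ij in \<open>simp add: \<sigma>_def\<close>)
      show "runs (Move i Go_Right) ((\<sigma> ys (z # zs))(j := zip_tape (w @ map f (ys @ [z])) []))
          (\<sigma> (ys @ [z]) zs) 1"
        by (rule runs_Move) (use ij in \<open>auto simp: \<sigma>_def fun_eq_iff\<close>)
    qed
  qed (use ij in \<open>simp add: \<sigma>_def P\<close>)
  moreover have "\<sigma> [] x = s" using s by (auto simp: \<sigma>_def)
  ultimately have "runs (transfer P f i j) s (\<sigma> x []) (length x * Suc (1 + 1) + 1)" by simp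
  then show ?thesis unfolding \<sigma>_def append_Nil append_Nil2 by (rule runs_mono) simp
qed

lemma runs_erase:
  assumes s: "s i = zip_tape u []"
  shows "runs (erase i) s (s(i := zip_tape [] [])) (2 * length u + 3)"
proof -
  define \<sigma> where "\<sigma> ys zs = s(i := shift Go_Left (zip_tape (rev zs) []))" for ys zs :: "'a list"
  have "runs (Move i Go_Left) s (\<sigma> [] (rev u)) 1"
    by (rule runs_Move) (simp add: \<sigma>_def s)
  moreover have "runs (While i i (\<lambda>x _. x \<noteq> None) (Do i i (\<lambda>_. (None, Go_Left))))
      (\<sigma> [] (rev u)) (\<sigma> (rev u) []) (length (rev u) * Suc 1 + 1)"
  proof (rule runs_While_list)
    show "runs (Do i i (\<lambda>_. (None, Go_Left))) (\<sigma> ys (z # zs)) (\<sigma> (ys @ [z]) zs) 1" for ys z zs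
      by (rule runs_Do) (simp add: \<sigma>_def shift_Left_zip_tape act_erase_last)
  qed (simp_all add: \<sigma>_def shift_Left_zip_tape)
  moreover have "runs (Move i Go_Right) (\<sigma> (rev u) []) (s(i := zip_tape [] [])) 1"
    by (rule runs_Move) (simp add: \<sigma>_def)
  ultimately have "runs (erase i) s (s(i := zip_tape [] [])) (1 + (length (rev u) * Suc 1 + 1 + 1))"
    unfolding erase_def by (intro runs_Seq)
  then show ?thesis by (rule runs_mono) simp
qed

section \<open>Comparing and scanning words\<close>

fun is_bit :: "letter option \<Rightarrow> bool" where
  "is_bit (Some (Bit _)) = True"
| "is_bit _ = False"

text \<open>A head inside a list of variables always reads an optional variable in this sense: past
  the last variable it meets the semicolon.\<close>

definition enc_item :: "var option \<Rightarrow> letter list" where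
  "enc_item p = (case p of None \<Rightarrow> [Semicolon] | Some x \<Rightarrow> enc_var x)"

definition next_word :: "nat \<Rightarrow> letter prog" where
  "next_word i = forward is_bit i ;; Move i Go_Right"

lemma runs_next_word:
  assumes "s i = zip_tape u (enc_var x @ v)"
  shows "runs (next_word i) s (s(i := zip_tape (u @ enc_var x) v)) (2 * length x + 2)"
proof -
  have "runs (forward is_bit i) s (s(i := zip_tape (u @ map Bit x) (Comma # v)))
      (2 * length (map Bit x) + 1)"
    by (rule runs_forward) (use assms in \<open>auto simp: enc_var_def\<close>)
  moreover have "runs (Move i Go_Right) (s(i := zip_tape (u @ map Bit x) (Comma # v)))
      (s(i := zip_tape (u @ enc_var x) v)) 1"
    by (rule runs_Move) (simp add: enc_var_def)
  ultimately have "runs (next_word i) s (s(i := zip_tape (u @ enc_var x) v))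
      (2 * length (map Bit x) + 1 + 1)"
    unfolding next_word_def by (rule runs_Seq)
  then show ?thesis by simp
qed

definition next_list :: "nat \<Rightarrow> letter prog" where
  "next_list i = forward (\<lambda>x. x \<noteq> Some Semicolon) i ;; Move i Go_Right"

definition enc_words :: "var list \<Rightarrow> letter list" where
  "enc_words xs = concat (map enc_var xs)"

lemma enc_words_simps [simp]:
  "enc_words [] = []" "enc_words (x # xs) = enc_var x @ enc_words xs"
  "enc_words (xs @ ys) = enc_words xs @ enc_words ys"
  by (simp_all add: enc_words_def)

lemma enc_vars_eq: "enc_vars xs = enc_words xs @ [Semicolon]"
  by (simp add: enc_vars_def enc_words_def)

lemma Semicolon_not_in_enc_words: "Semicolon \<notin> set (enc_words xs)"
  by (auto simp: enc_words_def enc_var_def)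

lemma runs_next_list:
  assumes "s i = zip_tape u (enc_vars xs @ v)"
  shows "runs (next_list i) s (s(i := zip_tape (u @ enc_vars xs) v)) (2 * length (enc_vars xs))"
proof -
  have "runs (forward (\<lambda>x. x \<noteq> Some Semicolon) i) s
      (s(i := zip_tape (u @ enc_words xs) (Semicolon # v))) (2 * length (enc_words xs) + 1)"
    by (rule runs_forward)
      (use assms Semicolon_not_in_enc_words[of xs] in \<open>auto simp: enc_vars_eq\<close>)
  moreover have "runs (Move i Go_Right) (s(i := zip_tape (u @ enc_words xs) (Semicolon # v)))
      (s(i := zip_tape (u @ enc_vars xs) v)) 1"
    by (rule runs_Move) (simp add: enc_vars_eq)
  ultimately have "runs (next_list i) s (s(i := zip_tape (u @ enc_vars xs) v))
      (2 * length (enc_words xs) + 1 + 1)"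
    unfolding next_list_def by (rule runs_Seq)
  then show ?thesis by (simp add: enc_vars_eq)
qed

text \<open>The flag is raised but never lowered, so consecutive comparisons compute a disjunction:
  over the elements of a list in \<open>member\<close>, over the two components of a pair in
  \<open>select_body\<close>. Both heads return, so that the words can be read again.\<close>

definition compare :: "nat \<Rightarrow> nat \<Rightarrow> nat \<Rightarrow> letter prog" where
  "compare i j k =
     While i j (\<lambda>x y. is_bit x \<and> x = y) (Move i Go_Right ;; Move j Go_Right) ;;
     When i j (\<lambda>x y. x = Some Comma \<and> y = Some Comma) (set_flag k True) ;;
     rewind is_bit i ;; rewind is_bit j"

text \<open>The loop stops after the common prefix \<open>c\<close> of bits. Since a comma ends
  every variable, the words agree iff both remainders start with a comma. Each symbol of
  \<open>c\<close> costs three steps forward and two in each rewind.\<close>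

lemma runs_compare_aux:
  assumes s: "s i = zip_tape u (c @ a @ v)" "s j = zip_tape u' (c @ b @ v')" "s k = flag_tape f"
    and c: "\<And>y. y \<in> set c \<Longrightarrow> is_bit (Some y)"
    and a: "a \<noteq> []" and b: "b \<noteq> []" and ab: "\<not> (is_bit (Some (hd a)) \<and> hd a = hd b)"
    and u: "stops is_bit (rev u)" "stops is_bit (rev u')"
    and neq: "i \<noteq> j" "i \<noteq> k" "j \<noteq> k"
  shows "runs (compare i j k) s
    (s(k := flag_tape (f \<or> hd a = Comma \<and> hd b = Comma))) (7 * length c + 9)"
proof -
  define \<sigma> where "\<sigma> ys zs =
    s(i := zip_tape (u @ ys) (zs @ a @ v), j := zip_tape (u' @ ys) (zs @ b @ v'))" for ys zs
  obtain a1 a2 b1 b2 where ab': "a = a1 # a2" "b = b1 # b2"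
    using a b by (metis list.exhaust)
  let ?g = "f \<or> hd a = Comma \<and> hd b = Comma"
  have 1: "runs (While i j (\<lambda>x y. is_bit x \<and> x = y) (Move i Go_Right ;; Move j Go_Right))
      (\<sigma> [] c) (\<sigma> c []) (length c * Suc (1 + 1) + 1)"
  proof (rule runs_While_list)
    show "runs (Move i Go_Right ;; Move j Go_Right) (\<sigma> ys (z # zs)) (\<sigma> (ys @ [z]) zs) (1 + 1)"
      for ys z zs
    proof (rule runs_Seq)
      show "runs (Move i Go_Right) (\<sigma> ys (z # zs))
          ((\<sigma> ys (z # zs))(i := zip_tape (u @ ys @ [z]) (zs @ a @ v))) 1"
        by (rule runs_Move) (use neq in \<open>simp add: \<sigma>_def\<close>)
      show "runs (Move j Go_Right) ((\<sigma> ys (z # zs))(i := zip_tape (u @ ys @ [z]) (zs @ a @ v)))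
          (\<sigma> (ys @ [z]) zs) 1"
        by (rule runs_Move) (use neq in \<open>simp add: \<sigma>_def fun_eq_iff\<close>)
    qed
  qed (use neq c ab in \<open>auto simp: \<sigma>_def ab'\<close>)
  have 2: "runs (When i j (\<lambda>x y. x = Some Comma \<and> y = Some Comma) (set_flag k True))
      (\<sigma> c []) ((\<sigma> c [])(k := flag_tape ?g)) (Suc 1)"
  proof (rule runs_When)
    assume "read_tape (\<sigma> c [] i) = Some Comma \<and> read_tape (\<sigma> c [] j) = Some Comma"
    then have "?g" using neq by (simp add: \<sigma>_def ab')
    then show "runs (set_flag k True) (\<sigma> c []) ((\<sigma> c [])(k := flag_tape ?g)) 1"
      by (intro runs_Do) (use s neq in \<open>simp add: \<sigma>_def\<close>)
  next
    assume "\<not> (read_tape (\<sigma> c [] i) = Some Comma \<and> read_tape (\<sigma> c [] j) = Some Comma)"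
    then have "?g = f" using neq by (auto simp: \<sigma>_def ab')
    then show "(\<sigma> c [])(k := flag_tape ?g) = \<sigma> c []"
      using s neq by (auto simp: \<sigma>_def fun_eq_iff)
  qed
  let ?s2 = "(\<sigma> c [])(k := flag_tape ?g)"
  have 3: "runs (rewind is_bit i) ?s2 (?s2(i := zip_tape u (c @ a @ v))) (2 * length c + 3)"
    by (rule runs_rewind) (use neq c u in \<open>auto simp: \<sigma>_def\<close>)
  have 4: "runs (rewind is_bit j) (?s2(i := zip_tape u (c @ a @ v)))
      (?s2(i := zip_tape u (c @ a @ v), j := zip_tape u' (c @ b @ v'))) (2 * length c + 3)"
    by (rule runs_rewind) (use neq c u in \<open>auto simp: \<sigma>_def\<close>)
  have start: "\<sigma> [] c = s" using s by (auto simp: \<sigma>_def)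
  have final: "?s2(i := zip_tape u (c @ a @ v), j := zip_tape u' (c @ b @ v'))
      = s(k := flag_tape ?g)"
    using s neq by (auto simp: \<sigma>_def fun_eq_iff)
  show ?thesis
    using runs_Seq[OF 1[unfolded start] runs_Seq[OF 2 runs_Seq[OF 3 4[unfolded final]]]]
    unfolding compare_def[symmetric] by (rule runs_mono) simp
qed

text \<open>Cuts both words at the first position where they differ or a word ends. Two semicolons
  do not count as a match, as they name no variable.\<close>

lemma enc_items_split:
  "\<exists>c a b. enc_item p = c @ a \<and> enc_item q = c @ b \<and> (\<forall>y\<in>set c. is_bit (Some y)) \<and>
    a \<noteq> [] \<and> b \<noteq> [] \<and> \<not> (is_bit (Some (hd a)) \<and> hd a = hd b) \<and>
    (hd a = Comma \<and> hd b = Comma \<longleftrightarrow> p = q \<and> p \<noteq> None)"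
proof (cases "p = None \<or> q = None")
  case True
  then show ?thesis
    by (intro exI[of _ "[]"] exI[of _ "enc_item p"] exI[of _ "enc_item q"])
      (auto simp: enc_item_def enc_var_def hd_append split: option.splits)
next
  case False
  then obtain x y where pq: "p = Some x" "q = Some y" by auto
  have "\<exists>c a b. enc_var x = c @ a \<and> enc_var y = c @ b \<and> (\<forall>y\<in>set c. is_bit (Some y)) \<and>
    a \<noteq> [] \<and> b \<noteq> [] \<and> \<not> (is_bit (Some (hd a)) \<and> hd a = hd b) \<and>
    (hd a = Comma \<and> hd b = Comma \<longleftrightarrow> x = y)"
  proof (induction x y rule: list_induct2')
    case (4 x xs y ys)
    show ?case
    proof (cases "x = y")
      case True
      obtain c a b where "enc_var xs = c @ a" "enc_var ys = c @ b" "\<forall>y\<in>set c. is_bit (Some y)"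
        "a \<noteq> []" "b \<noteq> []" "\<not> (is_bit (Some (hd a)) \<and> hd a = hd b)"
        "hd a = Comma \<and> hd b = Comma \<longleftrightarrow> xs = ys"
        using 4 by blast
      then show ?thesis
        by (intro exI[of _ "Bit x # c"] exI[of _ a] exI[of _ b])
          (auto simp: enc_var_def True)
    next
      case False
      then show ?thesis
        by (intro exI[of _ "[]"] exI[of _ "enc_var (x # xs)"] exI[of _ "enc_var (y # ys)"])
          (auto simp: enc_var_def)
    qed
  next
    case 1
    show ?case by (intro exI[of _ "[]"] exI[of _ "enc_var []"]) (auto simp: enc_var_def)
  next
    case (2 x xs)
    show ?case
      by (intro exI[of _ "[]"] exI[of _ "enc_var (x # xs)"] exI[of _ "enc_var []"])
        (auto simp: enc_var_def)
  next
    case (3 y ys)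
    show ?case
      by (intro exI[of _ "[]"] exI[of _ "enc_var []"] exI[of _ "enc_var (y # ys)"])
        (auto simp: enc_var_def)
  qed
  then show ?thesis by (simp add: pq enc_item_def)
qed

lemma runs_compare:
  assumes s: "s i = zip_tape u (enc_item p @ v)" "s j = zip_tape u' (enc_item q @ v')"
      "s k = flag_tape f"
    and u: "stops is_bit (rev u)" "stops is_bit (rev u')"
    and neq: "i \<noteq> j" "i \<noteq> k" "j \<noteq> k" and n: "length (enc_item p) \<le> n"
  shows "runs (compare i j k) s (s(k := flag_tape (f \<or> p = q \<and> p \<noteq> None))) (7 * n + 9)"
proof -
  obtain c a b where c: "enc_item p = c @ a" "enc_item q = c @ b" "\<forall>y\<in>set c. is_bit (Some y)"
    and ab: "a \<noteq> []" "b \<noteq> []" "\<not> (is_bit (Some (hd a)) \<and> hd a = hd b)"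
    and iff: "hd a = Comma \<and> hd b = Comma \<longleftrightarrow> p = q \<and> p \<noteq> None"
    using enc_items_split[of p q] by blast
  have "runs (compare i j k) s
      (s(k := flag_tape (f \<or> hd a = Comma \<and> hd b = Comma))) (7 * length c + 9)"
    by (rule runs_compare_aux[where u = u and a = a and v = v and u' = u' and b = b and v' = v'])
      (use s u neq c ab in auto)
  moreover have "7 * length c + 9 \<le> 7 * n + 9" using n \<open>enc_item p = c @ a\<close> by simp
  ultimately show ?thesis unfolding iff by (rule runs_mono)
qed

lemma stops_enc_words:
  "stops is_bit (rev u) \<Longrightarrow> stops is_bit (rev (u @ enc_words xs))"
  by (cases xs rule: rev_cases) (simp_all add: enc_var_def)

lemma stops_enc_vars: "stops is_bit (rev (u @ enc_vars xs))"
  by (simp add: enc_vars_eq)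

lemma read_enc_var: "read_tape (zip_tape u (enc_var x @ v)) \<noteq> Some Semicolon"
  by (cases x) (simp_all add: enc_var_def)

lemma length_le_enc_words: "length xs \<le> length (enc_words xs)"
  by (induction xs) (auto simp: enc_var_def)

lemma length_enc_words_member: "x \<in> set xs \<Longrightarrow> length (enc_var x) \<le> length (enc_words xs)"
  by (induction xs) auto

section \<open>Membership in an encoded list\<close>

definition member :: "nat \<Rightarrow> nat \<Rightarrow> nat \<Rightarrow> letter prog" where
  "member i j k = While j j (\<lambda>x _. x \<noteq> Some Semicolon) (compare i j k ;; next_word j) ;;
     Move j Go_Right"

text \<open>All time bounds are defined over commutative semirings, so that one expression yields a
  number from a number and a polynomial from a polynomial; see \<open>poly_solver_time\<close>. Here
  each of at most \<open>n\<close> elements costs a test, a comparison and a move to the next word;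
  the \<open>2\<close> is for the last test and the move past the semicolon.\<close>

definition member_time :: "'a::comm_semiring_1 \<Rightarrow> 'a" where
  "member_time n = n * (9 * n + 12) + 2"

lemma runs_member:
  assumes s: "s i = zip_tape u (enc_item p @ v)" "s j = zip_tape u' (enc_vars xs @ v')"
      "s k = flag_tape f"
    and u: "stops is_bit (rev u)" "stops is_bit (rev u')"
    and neq: "i \<noteq> j" "i \<noteq> k" "j \<noteq> k"
    and n: "length (enc_item p) \<le> n" "length (enc_vars xs) \<le> n"
  shows "runs (member i j k) s
    (s(j := zip_tape (u' @ enc_vars xs) v', k := flag_tape (f \<or> p \<in> Some ` set xs)))
    (member_time n)"
proof -
  define \<sigma> where "\<sigma> ys zs =
    s(j := zip_tape (u' @ enc_words ys) (enc_words zs @ Semicolon # v'),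
      k := flag_tape (f \<or> p \<in> Some ` set ys))" for ys zs
  have 1: "runs (While j j (\<lambda>x _. x \<noteq> Some Semicolon) (compare i j k ;; next_word j))
    (\<sigma> [] xs) (\<sigma> xs []) (length xs * Suc (7 * n + 9 + (2 * n + 2)) + 1)"
  proof (rule runs_While_list)
    fix ys z zs
    assume xs: "xs = ys @ z # zs"
    show "read_tape (\<sigma> ys (z # zs) j) \<noteq> Some Semicolon"
      using neq by (simp add: \<sigma>_def read_enc_var)
    let ?s = "(\<sigma> ys (z # zs))(k := flag_tape (f \<or> p \<in> Some ` set (ys @ [z])))"
    have "runs (compare i j k) (\<sigma> ys (z # zs))
        ((\<sigma> ys (z # zs))(k := flag_tape ((f \<or> p \<in> Some ` set ys) \<or> p = Some z \<and> p \<noteq> None)))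
        (7 * n + 9)"
      by (rule runs_compare[where u = u and v = v and u' = "u' @ enc_words ys"
            and v' = "enc_words zs @ Semicolon # v'"])
        (use s u neq n stops_enc_words in \<open>auto simp: \<sigma>_def enc_item_def\<close>)
    moreover have "((f \<or> p \<in> Some ` set ys) \<or> p = Some z \<and> p \<noteq> None) \<longleftrightarrow>
        (f \<or> p \<in> Some ` set (ys @ [z]))"
      by auto
    ultimately have "runs (compare i j k) (\<sigma> ys (z # zs)) ?s (7 * n + 9)"
      by (simp only:)
    moreover have "runs (next_word j) ?s (\<sigma> (ys @ [z]) zs) (2 * n + 2)"
    proof (rule runs_mono)
      have "runs (next_word j) ?s (?s(j := zip_tape ((u' @ enc_words ys) @ enc_var z)
          (enc_words zs @ Semicolon # v'))) (2 * length z + 2)"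
        by (rule runs_next_word) (use neq in \<open>simp add: \<sigma>_def\<close>)
      moreover have "?s(j := zip_tape ((u' @ enc_words ys) @ enc_var z)
          (enc_words zs @ Semicolon # v')) = \<sigma> (ys @ [z]) zs"
        using neq by (auto simp: \<sigma>_def fun_eq_iff)
      ultimately show "runs (next_word j) ?s (\<sigma> (ys @ [z]) zs) (2 * length z + 2)"
        by simp
      show "2 * length z + 2 \<le> 2 * n + 2"
        using n(2) by (simp add: xs enc_vars_eq enc_var_def)
    qed
    ultimately show "runs (compare i j k ;; next_word j) (\<sigma> ys (z # zs)) (\<sigma> (ys @ [z]) zs)
        (7 * n + 9 + (2 * n + 2))"
      by (rule runs_Seq)
  qed (use neq in \<open>simp add: \<sigma>_def\<close>)
  have 2: "runs (Move j Go_Right) (\<sigma> xs []) (s(j := zip_tape (u' @ enc_vars xs) v',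
      k := flag_tape (f \<or> p \<in> Some ` set xs))) 1"
    by (rule runs_Move) (use neq in \<open>auto simp: \<sigma>_def fun_eq_iff enc_vars_eq\<close>)
  have start: "\<sigma> [] xs = s" using s by (auto simp: \<sigma>_def enc_vars_eq)
  have "length xs * Suc (7 * n + 9 + (2 * n + 2)) \<le> n * Suc (7 * n + 9 + (2 * n + 2))"
    using n(2) length_le_enc_words[of xs] by (intro mult_le_mono1) (simp add: enc_vars_eq)
  then have "length xs * Suc (7 * n + 9 + (2 * n + 2)) + 1 + 1 \<le> member_time n"
    by (simp add: member_time_def algebra_simps)
  with runs_Seq[OF 1[unfolded start] 2] show ?thesis
    unfolding member_def[symmetric] by (rule runs_mono)
qed

section \<open>The machine\<close>

text \<open>
  Tape \<open>0\<close> rests at the end of the input and tape \<open>1\<close> at the end of the output. Tapes \<open>2\<close>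
  to \<open>5\<close> carry copies of the input whose heads point to a left variable, to a right variable, into
  the equations, and to the variable whose table entry is being written. Tape \<open>6\<close> counts pairs in
  unary, and tapes \<open>7\<close>, \<open>8\<close>, \<open>9\<close> hold flags.
\<close>

definition machine_state ::
    "letter list \<Rightarrow> letter list \<Rightarrow> letter tape \<Rightarrow> letter tape \<Rightarrow> letter tape \<Rightarrow> letter tape \<Rightarrow>
      nat \<Rightarrow> bool \<Rightarrow> bool \<Rightarrow> bool \<Rightarrow> nat \<Rightarrow> letter tape" where
  "machine_state w out ta tb te tx c f g h = (\<lambda>_. zip_tape [] [])
    (0 := zip_tape w [], 1 := zip_tape out [], 2 := ta, 3 := tb, 4 := te, 5 := tx,
     6 := zip_tape (replicate c (Bit True)) [], 7 := flag_tape f, 8 := flag_tape g,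
     9 := flag_tape h)"

lemma machine_state_nth [simp]:
  "machine_state w out ta tb te tx c f g h 0 = zip_tape w []"
  "machine_state w out ta tb te tx c f g h (Suc 0) = zip_tape out []"
  "machine_state w out ta tb te tx c f g h 2 = ta"
  "machine_state w out ta tb te tx c f g h 3 = tb"
  "machine_state w out ta tb te tx c f g h 4 = te"
  "machine_state w out ta tb te tx c f g h 5 = tx"
  "machine_state w out ta tb te tx c f g h 6 = zip_tape (replicate c (Bit True)) []"
  "machine_state w out ta tb te tx c f g h 7 = flag_tape f"
  "machine_state w out ta tb te tx c f g h 8 = flag_tape g"
  "machine_state w out ta tb te tx c f g h 9 = flag_tape h"
  by (simp_all add: machine_state_def)

lemma machine_state_upd [simp]:
  "(machine_state w out ta tb te tx c f g h)(0 := zip_tape w' []) =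
    machine_state w' out ta tb te tx c f g h"
  "(machine_state w out ta tb te tx c f g h)(Suc 0 := zip_tape out' []) =
    machine_state w out' ta tb te tx c f g h"
  "(machine_state w out ta tb te tx c f g h)(2 := t) = machine_state w out t tb te tx c f g h"
  "(machine_state w out ta tb te tx c f g h)(3 := t) = machine_state w out ta t te tx c f g h"
  "(machine_state w out ta tb te tx c f g h)(4 := t) = machine_state w out ta tb t tx c f g h"
  "(machine_state w out ta tb te tx c f g h)(5 := t) = machine_state w out ta tb te t c f g h"
  "(machine_state w out ta tb te tx c f g h)(6 := zip_tape (replicate c' (Bit True)) []) =
    machine_state w out ta tb te tx c' f g h"
  "(machine_state w out ta tb te tx c f g h)(6 := zip_tape [] []) =
    machine_state w out ta tb te tx 0 f g h"
  "(machine_state w out ta tb te tx c f g h)(7 := flag_tape b) =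
    machine_state w out ta tb te tx c b g h"
  "(machine_state w out ta tb te tx c f g h)(8 := flag_tape b) =
    machine_state w out ta tb te tx c f b h"
  "(machine_state w out ta tb te tx c f g h)(9 := flag_tape b) =
    machine_state w out ta tb te tx c f g b"
  by (auto simp: machine_state_def fun_eq_iff)

section \<open>Testing a pair against the encoded equations\<close>

definition enc_eqs :: "(var list \<times> var list) list \<Rightarrow> letter list" where
  "enc_eqs es = concat (map (\<lambda>(l, r). enc_vars l @ enc_vars r) es)"

lemma enc_eqs_simps [simp]:
  "enc_eqs [] = []" "enc_eqs ((l, r) # es) = enc_vars l @ enc_vars r @ enc_eqs es"
  "enc_eqs (es @ es') = enc_eqs es @ enc_eqs es'"
  by (simp_all add: enc_eqs_def)

lemma length_le_enc_eqs: "length es \<le> length (enc_eqs es)"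
  by (induction es) (auto simp: enc_vars_def)

lemma stops_enc_eqs: "stops is_bit (rev u) \<Longrightarrow> stops is_bit (rev (u @ enc_eqs es))"
  by (cases es rule: rev_cases) (auto simp: enc_vars_def)

definition set_eqs :: "(var list \<times> var list) list \<Rightarrow> (var set \<times> var set) set" where
  "set_eqs es = (\<lambda>(l, r). (set l, set r)) ` set es"

lemma compatible_set_eqs:
  "compatible (set_eqs []) pq"
  "compatible (set_eqs (es @ [(l, r)])) pq \<longleftrightarrow> compatible (set_eqs es) pq \<and>
    (fst pq \<in> Some ` set l \<longleftrightarrow> snd pq \<in> Some ` set r)"
  by (auto simp: set_eqs_def compatible_def)

text \<open>Flag \<open>9\<close> is only lowered here, so it accumulates a conjunction. Since
  \<open>member\<close> only raises flags \<open>7\<close> and \<open>8\<close>, they are reset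
  after each equation.\<close>

definition check_eqs :: "letter prog" where
  "check_eqs = While 4 4 (\<lambda>x _. x \<noteq> None)
     (member 2 4 7 ;; member 3 4 8 ;; When 7 8 (\<lambda>x y. x \<noteq> y) (set_flag 9 False) ;;
      set_flag 7 False ;; set_flag 8 False)"

definition check_eqs_time :: "'a::comm_semiring_1 \<Rightarrow> 'a" where
  "check_eqs_time n = n * (2 * member_time n + 5) + 1"

lemma runs_check_eqs:
  assumes ta: "ta = zip_tape ua (enc_item p @ va)" "stops is_bit (rev ua)" "length (enc_item p) \<le> n"
    and tb: "tb = zip_tape ub (enc_item q @ vb)" "stops is_bit (rev ub)" "length (enc_item q) \<le> n"
    and u: "stops is_bit (rev u)" and n: "length (enc_eqs es) \<le> n"
  shows "runs check_eqs
    (machine_state w out ta tb (zip_tape u (enc_eqs es)) tx c False False h)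
    (machine_state w out ta tb (zip_tape (u @ enc_eqs es) []) tx c False False
      (h \<and> compatible (set_eqs es) (p, q))) (check_eqs_time n)"
proof -
  define \<sigma> where "\<sigma> ys zs = machine_state w out ta tb (zip_tape (u @ enc_eqs ys) (enc_eqs zs)) tx c
    False False (h \<and> compatible (set_eqs ys) (p, q))" for ys zs
  have "runs check_eqs (\<sigma> [] es) (\<sigma> es []) (length es *
      Suc (member_time n + (member_time n + (Suc 1 + (1 + 1)))) + 1)"
    unfolding check_eqs_def
  proof (rule runs_While_list)
    fix ys z zs
    assume es: "es = ys @ z # zs"
    obtain l r where z: "z = (l, r)" by fastforce
    let ?f = "p \<in> Some ` set l" and ?g = "q \<in> Some ` set r"
    let ?h = "h \<and> compatible (set_eqs ys) (p, q)"
    have len: "length (enc_vars l) \<le> n" "length (enc_vars r) \<le> n"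
      using n by (simp_all add: es z)
    \<comment> \<open>Even an empty side is written with its semicolon, so the blank appears only
      after the last equation.\<close>
    show "read_tape (\<sigma> ys (z # zs) 4) \<noteq> None"
      by (cases l; cases "hd l") (simp_all add: \<sigma>_def z enc_vars_def enc_var_def)
    let ?s1 = "machine_state w out ta tb
      (zip_tape (u @ enc_eqs ys @ enc_vars l) (enc_vars r @ enc_eqs zs)) tx c ?f False ?h"
    let ?s2 = "machine_state w out ta tb (zip_tape (u @ enc_eqs (ys @ [z])) (enc_eqs zs)) tx c"
    let ?h' = "h \<and> compatible (set_eqs (ys @ [z])) (p, q)"
    have "runs (member 2 4 7) (\<sigma> ys (z # zs)) ((\<sigma> ys (z # zs))
        (4 := zip_tape ((u @ enc_eqs ys) @ enc_vars l) (enc_vars r @ enc_eqs zs),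
         7 := flag_tape (False \<or> ?f))) (member_time n)"
      by (rule runs_member[where u = ua and v = va])
        (use ta u len stops_enc_eqs in \<open>auto simp: \<sigma>_def z\<close>)
    then have 1: "runs (member 2 4 7) (\<sigma> ys (z # zs)) ?s1 (member_time n)"
      by (simp add: \<sigma>_def)
    have "runs (member 3 4 8) ?s1 (?s1
        (4 := zip_tape ((u @ enc_eqs ys @ enc_vars l) @ enc_vars r) (enc_eqs zs),
         8 := flag_tape (False \<or> ?g))) (member_time n)"
      by (rule runs_member[where u = ub and v = vb])
        (use tb len stops_enc_vars[of "u @ enc_eqs ys" l] in auto)
    then have 2: "runs (member 3 4 8) ?s1 (?s2 ?f ?g ?h) (member_time n)"
      by (simp add: z)
    have 3: "runs (When 7 8 (\<lambda>x y. x \<noteq> y) (set_flag 9 False)) (?s2 ?f ?g ?h) (?s2 ?f ?g ?h') (Suc 1)"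
    proof (rule runs_When)
      assume "read_tape (?s2 ?f ?g ?h 7) \<noteq> read_tape (?s2 ?f ?g ?h 8)"
      then have "?f \<noteq> ?g" by (cases ?f; cases ?g) simp_all
      then have "?h' = False" by (simp add: z compatible_set_eqs)
      moreover have "runs (set_flag 9 False) (?s2 ?f ?g ?h) (?s2 ?f ?g False) 1"
        by (rule runs_Do) simp
      ultimately show "runs (set_flag 9 False) (?s2 ?f ?g ?h) (?s2 ?f ?g ?h') 1"
        by (simp only:)
    next
      assume "\<not> read_tape (?s2 ?f ?g ?h 7) \<noteq> read_tape (?s2 ?f ?g ?h 8)"
      then have "?f = ?g" by (cases ?f; cases ?g) simp_all
      then have "?h' = ?h" by (simp add: z compatible_set_eqs)
      then show "?s2 ?f ?g ?h' = ?s2 ?f ?g ?h" by presburger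
    qed
    have 4: "runs (set_flag 7 False) (?s2 ?f ?g ?h') (?s2 False ?g ?h') 1"
      by (rule runs_Do) simp
    have 5: "runs (set_flag 8 False) (?s2 False ?g ?h') (?s2 False False ?h') 1"
      by (rule runs_Do) simp
    show "runs (member 2 4 7 ;; member 3 4 8 ;; When 7 8 (\<lambda>x y. x \<noteq> y) (set_flag 9 False) ;;
        set_flag 7 False ;; set_flag 8 False) (\<sigma> ys (z # zs)) (\<sigma> (ys @ [z]) zs)
        (member_time n + (member_time n + (Suc 1 + (1 + 1))))"
      unfolding \<sigma>_def[of "ys @ [z]"]
      by (intro runs_Seq[OF 1] runs_Seq[OF 2] runs_Seq[OF 3] runs_Seq[OF 4] 5)
  qed (simp add: \<sigma>_def)
  moreover have "length es * Suc (member_time n + (member_time n + (Suc 1 + (1 + 1)))) \<le>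
      n * Suc (member_time n + (member_time n + (Suc 1 + (1 + 1))))"
    using n length_le_enc_eqs[of es] by (intro mult_le_mono1) simp
  then have "length es * Suc (member_time n + (member_time n + (Suc 1 + (1 + 1)))) + 1
      \<le> check_eqs_time n"
    by (simp add: check_eqs_time_def algebra_simps)
  ultimately show ?thesis
    by (simp add: \<sigma>_def compatible_set_eqs runs_mono)
qed

section \<open>Writing the unary name of a pair\<close>

text \<open>Every symbol becomes \<open>Bit True\<close>, so the input tape contributes its length
  and tape \<open>6\<close> the index of the pair.\<close>

definition copy_ones :: "nat \<Rightarrow> letter prog" where
  "copy_ones i = rewind (\<lambda>x. x \<noteq> None) i ;; transfer (\<lambda>x. x \<noteq> None) (\<lambda>_. Bit True) i 1"

lemma runs_copy_ones:
  assumes "s i = zip_tape u []" "s 1 = zip_tape out []" "i \<noteq> 1"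
  shows "runs (copy_ones i) s (s(1 := zip_tape (out @ replicate (length u) (Bit True)) []))
    (5 * length u + 4)"
proof -
  have 1: "runs (rewind (\<lambda>x. x \<noteq> None) i) s (s(i := zip_tape [] (u @ []))) (2 * length u + 3)"
    by (rule runs_rewind) (use assms in simp_all)
  have "runs (transfer (\<lambda>x. x \<noteq> None) (\<lambda>_. Bit True) i 1) (s(i := zip_tape [] (u @ [])))
     (s(i := zip_tape [] (u @ []), i := zip_tape ([] @ u) [],
       1 := zip_tape (out @ map (\<lambda>_. Bit True) u) [])) (3 * length u + 1)"
    by (rule runs_transfer) (use assms in simp_all)
  moreover have "s(i := zip_tape [] (u @ []), i := zip_tape ([] @ u) [],
       1 := zip_tape (out @ map (\<lambda>_. Bit True) u) []) =
      s(1 := zip_tape (out @ replicate (length u) (Bit True)) [])"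
    using assms by (auto simp: fun_eq_iff map_replicate_const)
  ultimately have 2: "runs (transfer (\<lambda>x. x \<noteq> None) (\<lambda>_. Bit True) i 1)
      (s(i := zip_tape [] (u @ [])))
      (s(1 := zip_tape (out @ replicate (length u) (Bit True)) [])) (3 * length u + 1)"
    by (simp only:)
  show ?thesis
    unfolding copy_ones_def by (rule runs_mono[OF runs_Seq[OF 1 2]]) simp
qed

text \<open>The counter advances even if nothing is written. Thus a pair has the same name in the
  list of \<open>V\<close> and in every table entry.\<close>

definition emit :: "letter prog" where
  "emit = When 9 9 (\<lambda>x _. x \<noteq> None)
     (copy_ones 0 ;; copy_ones 6 ;; append_symbol 1 Comma ;; set_flag 9 False) ;;
     append_symbol 6 (Bit True)"

text \<open>\<open>(n + 1)\<^sup>2\<close> bounds the counter: each of the two lists, together with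
  its end, has at most \<open>n + 1\<close> items.\<close>

definition emit_time :: "'a::comm_semiring_1 \<Rightarrow> 'a" where
  "emit_time n = 5 * n + 5 * (n + 1)\<^sup>2 + 12"

lemma runs_emit:
  assumes "length w \<le> n" "c \<le> (n + 1)\<^sup>2"
  shows "runs emit (machine_state w out ta tb te tx c f g h)
    (machine_state w (out @ (if h then enc_var (replicate (length w + c) True) else []))
      ta tb te tx (Suc c) f g False) (emit_time n)"
proof -
  let ?s = "\<lambda>out. machine_state w out ta tb te tx"
  let ?o1 = "out @ replicate (length w) (Bit True)"
  let ?o2 = "?o1 @ replicate c (Bit True)"
  let ?o = "out @ (if h then enc_var (replicate (length w + c) True) else [])"
  let ?t = "(5 * length w + 4) + ((5 * c + 4) + (1 + 1))"
  have 1: "runs (When 9 9 (\<lambda>x _. x \<noteq> None)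
      (copy_ones 0 ;; copy_ones 6 ;; append_symbol 1 Comma ;; set_flag 9 False))
      (?s out c f g h) (?s ?o c f g False) (Suc ?t)"
  proof (rule runs_When)
    assume "read_tape (?s out c f g h 9) \<noteq> None"
    then have h: "h" by (simp split: if_splits)
    have 1: "runs (copy_ones 0) (?s out c f g h) (?s ?o1 c f g h) (5 * length w + 4)"
      using runs_copy_ones[of "?s out c f g h" 0 w out] by simp
    have 2: "runs (copy_ones 6) (?s ?o1 c f g h) (?s ?o2 c f g h) (5 * c + 4)"
      using runs_copy_ones[of "?s ?o1 c f g h" 6 "replicate c (Bit True)" ?o1] by simp
    have 3: "runs (append_symbol 1 Comma) (?s ?o2 c f g h) (?s ?o c f g h) 1"
      by (rule runs_Do) (simp add: h enc_var_def replicate_add)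
    have 4: "runs (set_flag 9 False) (?s ?o c f g h) (?s ?o c f g False) 1"
      by (rule runs_Do) simp
    show "runs (copy_ones 0 ;; copy_ones 6 ;; append_symbol 1 Comma ;; set_flag 9 False)
      (?s out c f g h) (?s ?o c f g False) ?t"
      by (intro runs_Seq[OF 1] runs_Seq[OF 2] runs_Seq[OF 3] 4)
  next
    assume "\<not> read_tape (?s out c f g h 9) \<noteq> None"
    then show "?s ?o c f g False = ?s out c f g h" by (simp split: if_splits)
  qed
  have 2: "runs (append_symbol 6 (Bit True)) (?s ?o c f g False) (?s ?o (Suc c) f g False) 1"
    by (rule runs_Do) (simp add: replicate_append_same flip: replicate_Suc)
  have "Suc ?t + 1 \<le> emit_time n"
    using assms by (simp add: emit_time_def)
  with runs_Seq[OF 1 2] show ?thesis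
    unfolding emit_def[symmetric] by (rule runs_mono)
qed

text \<open>The body also runs once with the head on the terminating semicolon, which encodes \<open>None\<close>.\<close>

definition each_item :: "nat \<Rightarrow> letter prog \<Rightarrow> letter prog" where
  "each_item i body = body ;; While i i (\<lambda>x _. x \<noteq> Some Semicolon) (next_word i ;; body)"

definition next_item :: "'a list \<Rightarrow> 'a option" where
  "next_item xs = (case xs of [] \<Rightarrow> None | x # _ \<Rightarrow> Some x)"

lemma next_item_simps [simp]: "next_item [] = None" "next_item (x # xs) = Some x"
  by (simp_all add: next_item_def)

abbreviation items :: "'a list \<Rightarrow> 'a option list" where
  "items xs \<equiv> map Some xs @ [None]"

definition list_tape :: "letter list \<Rightarrow> letter list \<Rightarrow> var list \<Rightarrow> var list \<Rightarrow> letter tape" where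
  "list_tape u v ys zs = zip_tape (u @ enc_words ys) (enc_words zs @ Semicolon # v)"

lemma list_tape_item:
  "\<exists>v'. list_tape u v ys zs = zip_tape (u @ enc_words ys) (enc_item (next_item zs) @ v')"
  by (cases zs) (auto simp: list_tape_def enc_item_def)

definition each_time :: "'a::comm_semiring_1 \<Rightarrow> 'a \<Rightarrow> 'a" where
  "each_time t n = t + (n * (2 * n + 3 + t) + 1)"

text \<open>\<open>S\<close> is any family of configurations indexed by the tape under tape head
  \<open>i\<close> and the items already treated. Leaving it abstract allows nested use, with the
  loop over the right list as part of the body for the left list.\<close>

lemma runs_each_item:
  assumes S: "\<And>t ds. S t ds i = t" "\<And>t t' ds. (S t ds)(i := t') = S t' ds"
    and body: "\<And>ys zs. xs = ys @ zs \<Longrightarrow> runs body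
      (S (list_tape u v ys zs) (map Some ys))
      (S (list_tape u v ys zs) (map Some ys @ [next_item zs])) t"
    and n: "length (enc_words xs) \<le> n"
  shows "runs (each_item i body) (S (list_tape u v [] xs) [])
    (S (list_tape u v xs []) (items xs)) (each_time t n)"
proof -
  \<comment> \<open>The test comes after the body, so the invariant already counts the item under
    the head as treated.\<close>
  define \<sigma> where "\<sigma> ys zs = S (list_tape u v ys zs) (map Some ys @ [next_item zs])" for ys zs
  have 1: "runs body (S (list_tape u v [] xs) []) (\<sigma> [] xs) t"
    using body[of "[]" xs] by (simp add: \<sigma>_def)
  have 2: "runs (While i i (\<lambda>x _. x \<noteq> Some Semicolon) (next_word i ;; body)) (\<sigma> [] xs) (\<sigma> xs [])
      (length xs * Suc (2 * n + 2 + t) + 1)"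
  proof (rule runs_While_list)
    fix ys z zs
    assume xs: "xs = ys @ z # zs"
    show "read_tape (\<sigma> ys (z # zs) i) \<noteq> Some Semicolon"
      by (simp add: \<sigma>_def S list_tape_def read_enc_var)
    let ?s = "S (list_tape u v (ys @ [z]) zs) (map Some (ys @ [z]))"
    have "runs (next_word i) (\<sigma> ys (z # zs)) ((\<sigma> ys (z # zs))
        (i := zip_tape ((u @ enc_words ys) @ enc_var z) (enc_words zs @ Semicolon # v)))
        (2 * length z + 2)"
      by (rule runs_next_word) (simp add: \<sigma>_def S list_tape_def)
    moreover have "2 * length z + 2 \<le> 2 * n + 2"
      using n by (simp add: xs enc_var_def)
    ultimately have "runs (next_word i) (\<sigma> ys (z # zs)) ?s (2 * n + 2)"
      by (simp add: \<sigma>_def S list_tape_def runs_mono)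
    moreover have "runs body ?s (\<sigma> (ys @ [z]) zs) t"
      using body[of "ys @ [z]" zs] by (simp add: \<sigma>_def xs)
    ultimately show "runs (next_word i ;; body) (\<sigma> ys (z # zs)) (\<sigma> (ys @ [z]) zs) (2 * n + 2 + t)"
      by (rule runs_Seq)
  qed (simp add: \<sigma>_def S list_tape_def)
  have "length xs * Suc (2 * n + 2 + t) \<le> n * Suc (2 * n + 2 + t)"
    using n length_le_enc_words[of xs] by (intro mult_le_mono1) simp
  then have "t + (length xs * Suc (2 * n + 2 + t) + 1) \<le> each_time t n"
    by (simp add: each_time_def algebra_simps)
  moreover have "\<sigma> xs [] = S (list_tape u v xs []) (items xs)"
    by (simp add: \<sigma>_def)
  ultimately show ?thesis
    using runs_Seq[OF 1 2] unfolding each_item_def[symmetric] by (simp add: runs_mono)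
qed

section \<open>The output of \<open>emit\<close> as a function on lists\<close>

text \<open>Rejected elements use up a number too, as on the counter tape.\<close>

fun numbered :: "('b \<Rightarrow> bool) \<Rightarrow> nat \<Rightarrow> 'b list \<Rightarrow> var list" where
  "numbered P k [] = []"
| "numbered P k (p # ps) = (if P p then [replicate k True] else []) @ numbered P (Suc k) ps"

lemma numbered_append:
  "numbered P k (ps @ qs) = numbered P k ps @ numbered P (k + length ps) qs"
  by (induction ps arbitrary: k) auto

lemma numbered_snoc:
  "numbered P k (ps @ [p]) =
    numbered P k ps @ (if P p then [replicate (k + length ps) True] else [])"
  by (simp add: numbered_append)

lemma set_numbered:
  "set (numbered P k ps) = (\<lambda>j. replicate (k + j) True) ` {j. j < length ps \<and> P (ps ! j)}"
proof (induction ps arbitrary: k)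
  case (Cons p ps)
  have "{j. j < length (p # ps) \<and> P ((p # ps) ! j)} =
      (if P p then {0} else {}) \<union> Suc ` {j. j < length ps \<and> P (ps ! j)}"
  proof (rule set_eqI)
    fix j
    show "j \<in> {j. j < length (p # ps) \<and> P ((p # ps) ! j)} \<longleftrightarrow>
        j \<in> (if P p then {0} else {}) \<union> Suc ` {j. j < length ps \<and> P (ps ! j)}"
      by (cases j) auto
  qed
  then show ?case using Cons[of "Suc k"] by (auto simp: image_iff)
qed simp

lemma product_snoc: "List.product (xs @ [x]) ys = List.product xs ys @ map (Pair x) ys"
  by (induction xs) auto

definition home :: "nat \<Rightarrow> letter prog" where
  "home i = rewind (\<lambda>x. x \<noteq> None) i"

lemma runs_home:
  assumes "s i = zip_tape u v" "length u \<le> n"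
  shows "runs (home i) s (s(i := zip_tape [] (u @ v))) (2 * n + 3)"
proof -
  have "runs (rewind (\<lambda>x. x \<noteq> None) i) s (s(i := zip_tape [] (u @ v))) (2 * length u + 3)"
    by (rule runs_rewind) (use assms in simp_all)
  then show ?thesis unfolding home_def by (rule runs_mono) (use assms in simp)
qed

definition all_pairs :: "letter prog \<Rightarrow> letter prog" where
  "all_pairs body = each_item 2 (each_item 3 body ;; home 3 ;; next_list 3) ;; home 2"

definition all_pairs_time :: "'a::comm_semiring_1 \<Rightarrow> 'a \<Rightarrow> 'a" where
  "all_pairs_time t n = each_time (each_time t n + (4 * n + 3)) n + (2 * n + 3)"

section \<open>Enumeration of all pairs on the tapes\<close>

locale system_code =
  fixes ls rs :: "var list" and es :: "(var list \<times> var list) list"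
begin

definition input :: "letter list" where
  "input = enc_vars ls @ enc_vars rs @ enc_eqs es"

abbreviation "n \<equiv> length input"

abbreviation "left_tape \<equiv> list_tape [] (enc_vars rs @ enc_eqs es)"

abbreviation "right_tape \<equiv> list_tape (enc_vars ls) (enc_eqs es)"

abbreviation "eqs_tape \<equiv> zip_tape (enc_vars ls @ enc_vars rs) (enc_eqs es)"

abbreviation "pairs \<equiv> List.product (items ls) (items rs)"

text \<open>Works from any head position: from the left end, exactly one list precedes the right
  variables.\<close>

lemma runs_home_right:
  assumes "s i = zip_tape u v" "u @ v = input"
  shows "runs (home i ;; next_list i) s (s(i := right_tape [] rs)) (4 * n + 3)"
proof -
  have 1: "runs (home i) s (s(i := zip_tape [] (u @ v))) (2 * n + 3)"
    by (rule runs_home) (use assms in \<open>auto simp flip: assms(2)\<close>)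
  have "runs (next_list i) (s(i := zip_tape [] (u @ v))) (s(i := zip_tape [] (u @ v),
      i := zip_tape ([] @ enc_vars ls) (enc_vars rs @ enc_eqs es))) (2 * length (enc_vars ls))"
    by (rule runs_next_list) (simp add: assms input_def)
  then have "runs (next_list i) (s(i := zip_tape [] (u @ v))) (s(i := right_tape [] rs))
      (2 * length (enc_vars ls))"
    by (simp add: list_tape_def enc_vars_eq[of rs])
  then show ?thesis
    by (rule runs_mono[OF runs_Seq[OF 1]]) (simp add: input_def)
qed

lemma runs_home_eqs:
  assumes "s i = zip_tape u v" "u @ v = input"
  shows "runs (home i ;; next_list i ;; next_list i) s (s(i := eqs_tape)) (6 * n + 3)"
proof -
  have 1: "runs (home i) s (s(i := zip_tape [] (u @ v))) (2 * n + 3)"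
    by (rule runs_home) (use assms in \<open>auto simp flip: assms(2)\<close>)
  have 2: "runs (next_list i) (s(i := zip_tape [] (u @ v))) (s(i := zip_tape [] (u @ v),
      i := zip_tape ([] @ enc_vars ls) (enc_vars rs @ enc_eqs es))) (2 * length (enc_vars ls))"
    by (rule runs_next_list) (simp add: assms input_def)
  have 3: "runs (next_list i) (s(i := zip_tape [] (u @ v),
      i := zip_tape ([] @ enc_vars ls) (enc_vars rs @ enc_eqs es)))
      (s(i := zip_tape [] (u @ v), i := zip_tape ([] @ enc_vars ls) (enc_vars rs @ enc_eqs es),
        i := zip_tape (([] @ enc_vars ls) @ enc_vars rs) (enc_eqs es)))
      (2 * length (enc_vars rs))"
    by (rule runs_next_list) simp
  show ?thesis
    by (rule runs_mono[OF runs_Seq[OF 1 runs_Seq[OF 2 3], simplified]]) (simp add: input_def)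
qed

text \<open>The contract under which \<open>all_pairs\<close> accepts a body. The bound on
  \<open>c\<close> limits the time for copying the counter, and \<open>pairs_bound\<close>
  guarantees it during the enumeration.\<close>

definition pair_body :: "(var option \<times> var option \<Rightarrow> bool) \<Rightarrow> letter tape \<Rightarrow> letter prog \<Rightarrow> nat \<Rightarrow> bool"
  where "pair_body P tx body t \<longleftrightarrow> (\<forall>out c ys zs ys' zs'.
    ls = ys @ zs \<longrightarrow> rs = ys' @ zs' \<longrightarrow> c \<le> (n + 1)\<^sup>2 \<longrightarrow>
    runs body
      (machine_state input out (left_tape ys zs) (right_tape ys' zs') eqs_tape tx c False False False)
      (machine_state input
        (out @ (if P (next_item zs, next_item zs') then enc_var (replicate (n + c) True) else []))
        (left_tape ys zs) (right_tape ys' zs') eqs_tape tx (Suc c) False False False) t)"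

lemma length_enc_words_ls: "length (enc_words ls) \<le> n" "length ls \<le> n"
  and length_enc_words_rs: "length (enc_words rs) \<le> n" "length rs \<le> n"
  using length_le_enc_words[of ls] length_le_enc_words[of rs]
  by (simp_all add: input_def enc_vars_eq)

lemma pairs_bound: "Suc (length ls) * Suc (length rs) \<le> (n + 1)\<^sup>2"
  unfolding power2_eq_square using length_enc_words_ls length_enc_words_rs
  by (intro mult_le_mono) simp_all

lemma runs_all_pairs:
  assumes body: "pair_body P tx body t"
  shows "runs (all_pairs body)
    (machine_state input out (left_tape [] ls) (right_tape [] rs) eqs_tape tx 0 False False False)
    (machine_state input (out @ enc_words (numbered P n pairs))
      (left_tape [] ls) (right_tape [] rs) eqs_tape tx (length pairs) False False False)
    (all_pairs_time t n)"
proof -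
  define S where "S ta tb ds c = machine_state input (out @ enc_words (numbered P n ds)) ta tb
    eqs_tape tx c False False False" for ta tb ds c
  have S_upd: "(S ta tb ds c)(2 := t') = S t' tb ds c" "(S ta tb ds c)(3 := t') = S ta t' ds c"
    "S ta tb ds c 2 = ta" "S ta tb ds c 3 = tb" for ta tb ds c t'
    by (simp_all add: S_def)
  have outer: "runs (each_item 3 body ;; home 3 ;; next_list 3)
      (S (left_tape ys zs) (right_tape [] rs) (List.product (map Some ys) (items rs))
        (length ys * Suc (length rs)))
      (S (left_tape ys zs) (right_tape [] rs)
        (List.product (map Some ys @ [next_item zs]) (items rs))
        (Suc (length ys) * Suc (length rs))) (each_time t n + (4 * n + 3))"
    if ls: "ls = ys @ zs" for ys zs
  proof -
    let ?ds = "List.product (map Some ys) (items rs)"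
    \<comment> \<open>The counter at the start of a row of \<open>List.product\<close>. A row has
      \<open>Suc (length rs)\<close> pairs because it includes \<open>None\<close>.\<close>
    let ?c = "length ys * Suc (length rs)"
    let ?es = "\<lambda>ds. ?ds @ map (Pair (next_item zs)) ds"
    have inner: "runs body
        (S (left_tape ys zs) (right_tape ys' zs') (?es (map Some ys')) (?c + length (map Some ys')))
        (S (left_tape ys zs) (right_tape ys' zs') (?es (map Some ys' @ [next_item zs']))
          (?c + length (map Some ys' @ [next_item zs']))) t"
      if rs: "rs = ys' @ zs'" for ys' zs'
    proof -
      have len: "length (?es (map Some ys')) = ?c + length ys'"
        by (simp add: length_product)
      have "?c + length ys' \<le> Suc (length ls) * Suc (length rs)"
        using mult_le_mono1[of "length ys" "length ls" "Suc (length rs)"] by (simp add: ls rs)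
      then have "?c + length ys' \<le> (n + 1)\<^sup>2"
        using pairs_bound by linarith
      with body ls rs have "runs body
          (S (left_tape ys zs) (right_tape ys' zs') (?es (map Some ys')) (?c + length ys'))
          (machine_state input ((out @ enc_words (numbered P n (?es (map Some ys')))) @
            (if P (next_item zs, next_item zs') then enc_var (replicate (n + (?c + length ys')) True)
              else []))
          (left_tape ys zs) (right_tape ys' zs') eqs_tape tx (Suc (?c + length ys'))
          False False False) t"
        unfolding pair_body_def S_def by blast
      moreover have "?es (map Some ys' @ [next_item zs']) =
          ?es (map Some ys') @ [(next_item zs, next_item zs')]"
        by simp
      then have "enc_words (numbered P n (?es (map Some ys' @ [next_item zs']))) =
          enc_words (numbered P n (?es (map Some ys'))) @
          (if P (next_item zs, next_item zs') then enc_var (replicate (n + (?c + length ys')) True)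
            else [])"
        by (simp only: numbered_snoc len) simp
      ultimately show ?thesis
        unfolding S_def by (simp only: append_assoc length_append length_map list.size
            add_0_right add_Suc_right)
    qed
    have "runs (each_item 3 body)
        (S (left_tape ys zs) (right_tape [] rs) (?es []) (?c + length ([] :: var option list)))
        (S (left_tape ys zs) (right_tape rs []) (?es (items rs)) (?c + length (items rs)))
        (each_time t n)"
      by (rule runs_each_item[where S = "\<lambda>tb ds. S (left_tape ys zs) tb (?es ds) (?c + length ds)"])
        (use inner length_enc_words_rs in \<open>simp_all only: S_upd\<close>)
    then have 1: "runs (each_item 3 body)
        (S (left_tape ys zs) (right_tape [] rs) ?ds ?c)
        (S (left_tape ys zs) (right_tape rs []) (?es (items rs)) (Suc (length ys) * Suc (length rs)))
        (each_time t n)"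
      by (simp add: algebra_simps)
    have "runs (home 3 ;; next_list 3)
        (S (left_tape ys zs) (right_tape rs []) (?es (items rs)) (Suc (length ys) * Suc (length rs)))
        ((S (left_tape ys zs) (right_tape rs []) (?es (items rs))
          (Suc (length ys) * Suc (length rs)))(3 := right_tape [] rs)) (4 * n + 3)"
      by (rule runs_home_right[where u = "enc_vars ls @ enc_words rs" and v = "Semicolon # enc_eqs es"])
        (simp_all add: S_upd list_tape_def input_def enc_vars_eq)
    with runs_Seq[OF 1] show ?thesis
      by (simp only: S_upd product_snoc)
  qed
  have 1: "runs (each_item 2 (each_item 3 body ;; home 3 ;; next_list 3))
      (S (left_tape [] ls) (right_tape [] rs) (List.product [] (items rs))
        (length ([] :: var option list) * Suc (length rs)))
      (S (left_tape ls []) (right_tape [] rs) pairs (length (items ls) * Suc (length rs)))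
      (each_time (each_time t n + (4 * n + 3)) n)"
    by (rule runs_each_item[where S =
          "\<lambda>ta ds. S ta (right_tape [] rs) (List.product ds (items rs)) (length ds * Suc (length rs))"])
      (use outer length_enc_words_ls in \<open>simp_all only: S_upd length_append length_map list.size
        add_0_right add_Suc_right One_nat_def\<close>)
  have 2: "runs (home 2)
      (S (left_tape ls []) (right_tape [] rs) pairs (length (items ls) * Suc (length rs)))
      (S (left_tape [] ls) (right_tape [] rs) pairs (length (items ls) * Suc (length rs))) (2 * n + 3)"
    using runs_home[of "S (left_tape ls []) (right_tape [] rs) pairs
        (length (items ls) * Suc (length rs))" 2 "enc_words ls" "Semicolon # enc_vars rs @ enc_eqs es" n]
      length_enc_words_ls
    by (simp add: S_upd list_tape_def)
  have "length (items ls) * Suc (length rs) = length pairs"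
    by (simp add: length_product)
  with runs_Seq[OF 1 2] show ?thesis
    unfolding all_pairs_def all_pairs_time_def by (simp add: S_def)
qed

end

section \<open>The solver program and its time bounds\<close>

definition every_body :: "letter prog" where
  "every_body = set_flag 9 True ;; emit"

text \<open>The order matters: the comparisons raise flag \<open>9\<close> if the variable occurs in
  the pair, and \<open>check_eqs\<close> then lowers it if an equation fails.\<close>

definition select_body :: "letter prog" where
  "select_body = compare 5 2 9 ;; compare 5 3 9 ;; check_eqs ;;
     (home 4 ;; next_list 4 ;; next_list 4) ;; emit"

definition select_time :: "'a::comm_semiring_1 \<Rightarrow> 'a" where
  "select_time n = (7 * n + 9) + ((7 * n + 9) + (check_eqs_time n + ((6 * n + 3) + emit_time n)))"

text \<open>Copying the variable moves the head past its bits, so tape \<open>5\<close> is rewound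
  for the comparisons. Erasing the counter makes the next entry start with the same names.\<close>

definition entry :: "letter prog" where
  "entry = transfer is_bit (\<lambda>x. x) 5 1 ;; append_symbol 1 Comma ;; rewind is_bit 5 ;;
     all_pairs select_body ;; erase 6 ;; append_symbol 1 Semicolon ;; next_word 5"

definition entry_time :: "'a::comm_semiring_1 \<Rightarrow> 'a" where
  "entry_time n = (3 * n + 1) + (1 + ((2 * n + 3) + (all_pairs_time (select_time n) n +
     ((2 * (n + 1)\<^sup>2 + 3) + (1 + (2 * n + 2))))))"

definition entries :: "letter prog" where
  "entries = While 5 5 (\<lambda>x _. x \<noteq> Some Semicolon) entry ;; Move 5 Go_Right"

definition entries_time :: "'a::comm_semiring_1 \<Rightarrow> 'a" where
  "entries_time n = n * (entry_time n + 1) + 2"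

definition copy_input :: "nat \<Rightarrow> letter prog" where
  "copy_input j = transfer (\<lambda>x. x \<noteq> None) (\<lambda>x. x) 0 j ;; home 0"

lemma runs_copy_input:
  assumes "s 0 = zip_tape [] w" "s j = zip_tape [] []" "j \<noteq> 0"
  shows "runs (copy_input j) s (s(j := zip_tape w [])) (5 * length w + 4)"
proof -
  have 1: "runs (transfer (\<lambda>x. x \<noteq> None) (\<lambda>x. x) 0 j) s
      (s(0 := zip_tape ([] @ w) [], j := zip_tape ([] @ map (\<lambda>x. x) w) [])) (3 * length w + 1)"
    by (rule runs_transfer) (use assms in simp_all)
  have 2: "runs (home 0) (s(0 := zip_tape ([] @ w) [], j := zip_tape ([] @ map (\<lambda>x. x) w) []))
      (s(0 := zip_tape ([] @ w) [], j := zip_tape ([] @ map (\<lambda>x. x) w) [],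
        0 := zip_tape [] (w @ []))) (2 * length w + 3)"
    by (rule runs_home) (use assms in simp_all)
  have "s(0 := zip_tape ([] @ w) [], j := zip_tape ([] @ map (\<lambda>x. x) w) [],
      0 := zip_tape [] (w @ [])) = s(j := zip_tape w [])"
    using assms by (auto simp: fun_eq_iff)
  with 2 have 2: "runs (home 0) (s(0 := zip_tape ([] @ w) [], j := zip_tape ([] @ map (\<lambda>x. x) w) []))
      (s(j := zip_tape w [])) (2 * length w + 3)"
    by (simp only:)
  show ?thesis
    unfolding copy_input_def by (rule runs_mono[OF runs_Seq[OF 1 2]]) simp
qed

definition machine_init :: "letter prog" where
  "machine_init = copy_input 2 ;; copy_input 3 ;; copy_input 4 ;; copy_input 5 ;;
     forward (\<lambda>x. x \<noteq> None) 0 ;; home 2 ;; (home 3 ;; next_list 3) ;;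
     (home 4 ;; next_list 4 ;; next_list 4) ;; home 5"

text \<open>The two runs of \<open>entries\<close> serve the left and the right variables: the first
  leaves tape \<open>5\<close> at the start of the second list.\<close>

definition solver :: "letter prog" where
  "solver = machine_init ;; all_pairs every_body ;; erase 6 ;; append_symbol 1 Semicolon ;;
     entries ;; entries"

definition solver_time :: "'a::comm_semiring_1 \<Rightarrow> 'a" where
  "solver_time n = (36 * n + 31) + (all_pairs_time (1 + emit_time n) n +
     ((2 * (n + 1)\<^sup>2 + 3) + (1 + (entries_time n + entries_time n))))"

lemmas prog_defs = solver_def machine_init_def copy_input_def entries_def entry_def select_body_def
  every_body_def all_pairs_def each_item_def home_def emit_def copy_ones_def check_eqs_def member_def
  compare_def next_list_def next_word_def erase_def transfer_def forward_def rewind_def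

lemma tapes_below_solver: "tapes_below 10 solver"
  by (simp add: prog_defs)

section \<open>Correctness of the solver\<close>

context system_code
begin

abbreviation "selects x pq \<equiv>
  (Some x = fst pq \<or> Some x = snd pq) \<and> compatible (set_eqs es) pq"

lemma length_next_item:
  "length (enc_item (next_item zs)) \<le> Suc (length (enc_words zs))"
  by (cases zs) (simp_all add: enc_item_def)

lemma pair_body_every: "pair_body (\<lambda>_. True) tx every_body (1 + emit_time n)"
  unfolding pair_body_def every_body_def
proof (intro allI impI)
  fix out c ys zs ys' zs'
  assume c: "c \<le> (n + 1)\<^sup>2"
  let ?s = "\<lambda>out. machine_state input out (left_tape ys zs) (right_tape ys' zs') eqs_tape tx"
  have 1: "runs (set_flag 9 True) (?s out c False False False) (?s out c False False True) 1"
    by (rule runs_Do) simp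
  show "runs (set_flag 9 True ;; emit) (?s out c False False False)
      (?s (out @ (if True then enc_var (replicate (n + c) True) else [])) (Suc c) False False False)
      (1 + emit_time n)"
    using runs_emit[OF order_refl c, where h = True] by (intro runs_Seq[OF 1]) simp
qed

lemma pair_body_select:
  assumes tx: "tx = zip_tape u (enc_var x @ v)" and u: "stops is_bit (rev u)"
    and len: "length (enc_var x) \<le> n"
  shows "pair_body (selects x) tx select_body (select_time n)"
  unfolding pair_body_def select_body_def select_time_def
proof (intro allI impI)
  fix out c ys zs ys' zs'
  assume ls: "ls = ys @ zs" and rs: "rs = ys' @ zs'" and c: "c \<le> (n + 1)\<^sup>2"
  let ?p = "next_item zs" and ?q = "next_item zs'"
  let ?s = "\<lambda>te. machine_state input out (left_tape ys zs) (right_tape ys' zs') te tx c False False"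
  \<comment> \<open>\<open>?h1\<close>, \<open>?h2\<close> and \<open>?h\<close> are the successive
    values of flag \<open>9\<close>.\<close>
  let ?h1 = "Some x = ?p" and ?h2 = "Some x = ?p \<or> Some x = ?q"
  let ?h = "?h2 \<and> compatible (set_eqs es) (?p, ?q)"
  obtain va where ta: "left_tape ys zs = zip_tape ([] @ enc_words ys) (enc_item ?p @ va)"
    using list_tape_item by blast
  obtain vb where tb: "right_tape ys' zs' = zip_tape (enc_vars ls @ enc_words ys') (enc_item ?q @ vb)"
    using list_tape_item by blast
  have ua: "stops is_bit (rev ([] @ enc_words ys))"
    by (rule stops_enc_words) simp
  have ub: "stops is_bit (rev (enc_vars ls @ enc_words ys'))"
    by (rule stops_enc_words) (use stops_enc_vars[of "[]" ls] in simp)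
  have ue: "stops is_bit (rev (enc_vars ls @ enc_vars rs))"
    by (rule stops_enc_vars)
  have len_p: "length (enc_item ?p) \<le> n" and len_q: "length (enc_item ?q) \<le> n"
  proof -
    have "Suc (length (enc_words ls)) \<le> n" "Suc (length (enc_words rs)) \<le> n"
      by (simp_all add: input_def enc_vars_eq)
    moreover have "length (enc_words zs) \<le> length (enc_words ls)"
      "length (enc_words zs') \<le> length (enc_words rs)"
      by (simp_all add: ls rs)
    ultimately show "length (enc_item ?p) \<le> n" "length (enc_item ?q) \<le> n"
      using length_next_item[of zs] length_next_item[of zs'] by linarith+
  qed
  have "runs (compare 5 2 9) (?s eqs_tape False)
      ((?s eqs_tape False)(9 := flag_tape (False \<or> Some x = ?p \<and> Some x \<noteq> None))) (7 * n + 9)"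
    by (rule runs_compare[OF _ _ _ u ua]) (use tx ta len in \<open>auto simp: enc_item_def\<close>)
  then have 1: "runs (compare 5 2 9) (?s eqs_tape False) (?s eqs_tape ?h1) (7 * n + 9)"
    by simp
  have "runs (compare 5 3 9) (?s eqs_tape ?h1)
      ((?s eqs_tape ?h1)(9 := flag_tape (?h1 \<or> Some x = ?q \<and> Some x \<noteq> None))) (7 * n + 9)"
    by (rule runs_compare[OF _ _ _ u ub]) (use tx tb len in \<open>auto simp: enc_item_def\<close>)
  then have 2: "runs (compare 5 3 9) (?s eqs_tape ?h1) (?s eqs_tape ?h2) (7 * n + 9)"
    by simp
  let ?te = "zip_tape ((enc_vars ls @ enc_vars rs) @ enc_eqs es) []"
  have 3: "runs check_eqs (?s eqs_tape ?h2) (?s ?te ?h) (check_eqs_time n)"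
    by (rule runs_check_eqs[OF ta ua len_p tb ub len_q ue]) (simp add: input_def)
  have "runs (home 4 ;; next_list 4 ;; next_list 4) (?s ?te ?h) ((?s ?te ?h)(4 := eqs_tape)) (6 * n + 3)"
    by (rule runs_home_eqs[where u = input and v = "[]"]) (simp_all add: input_def)
  then have 4: "runs (home 4 ;; next_list 4 ;; next_list 4) (?s ?te ?h) (?s eqs_tape ?h) (6 * n + 3)"
    by simp
  have "?h \<longleftrightarrow> selects x (?p, ?q)"
    by simp
  then show "runs (compare 5 2 9 ;; compare 5 3 9 ;; check_eqs ;;
      (home 4 ;; next_list 4 ;; next_list 4) ;; emit) (?s eqs_tape False)
      (machine_state input
        (out @ (if selects x (?p, ?q) then enc_var (replicate (n + c) True) else []))
        (left_tape ys zs) (right_tape ys' zs') eqs_tape tx (Suc c) False False False)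
      (7 * n + 9 + (7 * n + 9 + (check_eqs_time n + (6 * n + 3 + emit_time n))))"
    using runs_emit[OF order_refl c, where h = ?h]
    by (intro runs_Seq[OF 1] runs_Seq[OF 2] runs_Seq[OF 3] runs_Seq[OF 4]) (simp only:)
qed

definition state :: "letter list \<Rightarrow> letter tape \<Rightarrow> nat \<Rightarrow> nat \<Rightarrow> letter tape" where
  "state out tx c = machine_state input out (left_tape [] ls) (right_tape [] rs) eqs_tape tx c
     False False False"

lemma state_simps [simp]:
  "state out tx c (Suc 0) = zip_tape out []"
  "state out tx c 5 = tx"
  "state out tx c 6 = zip_tape (replicate c (Bit True)) []"
  "(state out tx c)(Suc 0 := zip_tape out' []) = state out' tx c"
  "(state out tx c)(5 := tx') = state out tx' c"
  "(state out tx c)(6 := zip_tape [] []) = state out tx 0"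
  by (simp_all add: state_def)

lemma runs_erase_counter:
  "runs (erase 6) (state out tx (length pairs)) (state out tx 0) (2 * (n + 1)\<^sup>2 + 3)"
proof -
  have "length pairs \<le> (n + 1)\<^sup>2"
    using pairs_bound by (simp add: length_product algebra_simps)
  then show ?thesis
    using runs_erase[of "state out tx (length pairs)" 6 "replicate (length pairs) (Bit True)"]
    by (simp add: runs_mono)
qed

definition table_entry :: "var \<Rightarrow> letter list" where
  "table_entry x = enc_var x @ enc_vars (numbered (selects x) n pairs)"

lemma runs_entry:
  assumes u: "stops is_bit (rev u)" and len: "length (enc_var x) \<le> n"
  shows "runs entry (state out (zip_tape u (enc_var x @ v)) 0)
    (state (out @ table_entry x) (zip_tape (u @ enc_var x) v) 0) (entry_time n)"
proof -
  let ?tx = "zip_tape u (enc_var x @ v)"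
  let ?tx' = "zip_tape (u @ map Bit x) (Comma # v)"
  let ?o1 = "out @ map Bit x" and ?o2 = "out @ enc_var x"
  let ?o3 = "?o2 @ enc_words (numbered (selects x) n pairs)"
  have lx: "length x \<le> n" using len by (simp add: enc_var_def)
  have "runs (transfer is_bit (\<lambda>x. x) 5 1) (state out ?tx 0)
      ((state out ?tx 0)(5 := ?tx', 1 := zip_tape (out @ map (\<lambda>x. x) (map Bit x)) []))
      (3 * length (map Bit x) + 1)"
    by (rule runs_transfer) (auto simp: enc_var_def)
  then have 1: "runs (transfer is_bit (\<lambda>x. x) 5 1) (state out ?tx 0) (state ?o1 ?tx' 0) (3 * n + 1)"
    using lx by (simp add: runs_mono)
  have 2: "runs (append_symbol 1 Comma) (state ?o1 ?tx' 0) (state ?o2 ?tx' 0) 1"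
    by (rule runs_Do) (simp add: enc_var_def)
  have "runs (rewind is_bit 5) (state ?o2 ?tx' 0)
      ((state ?o2 ?tx' 0)(5 := zip_tape u (map Bit x @ Comma # v))) (2 * length (map Bit x) + 3)"
    by (rule runs_rewind) (use u in auto)
  then have 3: "runs (rewind is_bit 5) (state ?o2 ?tx' 0) (state ?o2 ?tx 0) (2 * n + 3)"
    using lx by (simp add: runs_mono enc_var_def)
  have 4: "runs (all_pairs select_body) (state ?o2 ?tx 0) (state ?o3 ?tx (length pairs))
      (all_pairs_time (select_time n) n)"
    unfolding state_def by (rule runs_all_pairs[OF pair_body_select[OF refl u len]])
  have 5: "runs (append_symbol 1 Semicolon) (state ?o3 ?tx 0) (state (out @ table_entry x) ?tx 0) 1"
    by (rule runs_Do) (simp add: table_entry_def enc_vars_eq)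
  have "runs (next_word 5) (state (out @ table_entry x) ?tx 0)
      ((state (out @ table_entry x) ?tx 0)(5 := zip_tape (u @ enc_var x) v)) (2 * length x + 2)"
    by (rule runs_next_word) simp
  then have 6: "runs (next_word 5) (state (out @ table_entry x) ?tx 0)
      (state (out @ table_entry x) (zip_tape (u @ enc_var x) v) 0) (2 * n + 2)"
    using lx by (simp add: runs_mono)
  show ?thesis
    unfolding entry_def entry_time_def
    by (intro runs_Seq[OF 1] runs_Seq[OF 2] runs_Seq[OF 3] runs_Seq[OF 4]
        runs_Seq[OF runs_erase_counter] runs_Seq[OF 5] 6)
qed

lemma runs_entries:
  assumes u: "stops is_bit (rev u)" and len: "length (enc_words xs) \<le> n"
  shows "runs entries (state out (zip_tape u (enc_vars xs @ v)) 0)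
    (state (out @ concat (map table_entry xs)) (zip_tape (u @ enc_vars xs) v) 0) (entries_time n)"
proof -
  define \<sigma> where "\<sigma> ys zs = state (out @ concat (map table_entry ys))
    (zip_tape (u @ enc_words ys) (enc_words zs @ Semicolon # v)) 0" for ys zs
  have 1: "runs (While 5 5 (\<lambda>x _. x \<noteq> Some Semicolon) entry) (\<sigma> [] xs) (\<sigma> xs [])
      (length xs * Suc (entry_time n) + 1)"
  proof (rule runs_While_list)
    fix ys z zs
    assume xs: "xs = ys @ z # zs"
    show "read_tape (\<sigma> ys (z # zs) 5) \<noteq> Some Semicolon"
      by (simp add: \<sigma>_def read_enc_var)
    have "runs entry
        (state (out @ concat (map table_entry ys))
          (zip_tape (u @ enc_words ys) (enc_var z @ enc_words zs @ Semicolon # v)) 0)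
        (state ((out @ concat (map table_entry ys)) @ table_entry z)
          (zip_tape ((u @ enc_words ys) @ enc_var z) (enc_words zs @ Semicolon # v)) 0) (entry_time n)"
      by (rule runs_entry) (use stops_enc_words[OF u] len in \<open>simp_all add: xs\<close>)
    then show "runs entry (\<sigma> ys (z # zs)) (\<sigma> (ys @ [z]) zs) (entry_time n)"
      by (simp add: \<sigma>_def)
  qed (simp add: \<sigma>_def)
  have 2: "runs (Move 5 Go_Right) (\<sigma> xs [])
      (state (out @ concat (map table_entry xs)) (zip_tape (u @ enc_vars xs) v) 0) 1"
    by (rule runs_Move) (simp add: \<sigma>_def enc_vars_eq)
  have "length xs * Suc (entry_time n) \<le> n * Suc (entry_time n)"
    using len length_le_enc_words[of xs] by (intro mult_le_mono1) simp
  then have "length xs * Suc (entry_time n) + 1 + 1 \<le> entries_time n"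
    by (simp add: entries_time_def)
  moreover have "\<sigma> [] xs = state out (zip_tape u (enc_vars xs @ v)) 0"
    by (simp add: \<sigma>_def enc_vars_eq)
  ultimately show ?thesis
    using runs_Seq[OF 1 2] unfolding entries_def[symmetric] by (simp add: runs_mono)
qed

lemma runs_machine_init:
  "runs machine_init (\<lambda>j. (word_on_tape (if j = 0 then input else []), 0))
    (state [] (zip_tape [] input) 0) (36 * n + 31)"
proof -
  \<comment> \<open>\<open>machine_state\<close> fixes the head of tape \<open>0\<close> at the end
    of the input; during the setup it moves, so a different description is used.\<close>
  define s where "s tw ta tb te tx = (\<lambda>_ :: nat. zip_tape [] [])
    (0 := tw, 2 := ta, 3 := tb, 4 := te, 5 := tx)" for tw ta tb te tx :: "letter tape"
  have s_nth: "s tw ta tb te tx 0 = tw" "s tw ta tb te tx 2 = ta" "s tw ta tb te tx 3 = tb"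
    "s tw ta tb te tx 4 = te" "s tw ta tb te tx 5 = tx"
    and s_upd: "(s tw ta tb te tx)(0 := t) = s t ta tb te tx"
    "(s tw ta tb te tx)(2 := t) = s tw t tb te tx" "(s tw ta tb te tx)(3 := t) = s tw ta t te tx"
    "(s tw ta tb te tx)(4 := t) = s tw ta tb t tx" "(s tw ta tb te tx)(5 := t) = s tw ta tb te t"
    for tw ta tb te tx t
    by (auto simp: s_def fun_eq_iff)
  let ?e = "zip_tape [] []" and ?w = "zip_tape input []" and ?h = "zip_tape [] input"
  have start: "(\<lambda>j. (word_on_tape (if j = 0 then input else []), 0)) = s ?h ?e ?e ?e ?e"
    by (auto simp: s_def zip_tape_def fun_eq_iff)
  have final: "s ?w ?h (right_tape [] rs) eqs_tape ?h = state [] ?h 0"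
    by (auto simp: s_def state_def machine_state_def flag_tape_def fun_eq_iff list_tape_def
        input_def enc_vars_eq)
  have 1: "runs (copy_input 2) (s ?h ?e ?e ?e ?e) (s ?h ?w ?e ?e ?e) (5 * n + 4)"
    using runs_copy_input[of "s ?h ?e ?e ?e ?e" input 2] by (simp add: s_nth s_upd)
  have 2: "runs (copy_input 3) (s ?h ?w ?e ?e ?e) (s ?h ?w ?w ?e ?e) (5 * n + 4)"
    using runs_copy_input[of "s ?h ?w ?e ?e ?e" input 3] by (simp add: s_nth s_upd)
  have 3: "runs (copy_input 4) (s ?h ?w ?w ?e ?e) (s ?h ?w ?w ?w ?e) (5 * n + 4)"
    using runs_copy_input[of "s ?h ?w ?w ?e ?e" input 4] by (simp add: s_nth s_upd)
  have 4: "runs (copy_input 5) (s ?h ?w ?w ?w ?e) (s ?h ?w ?w ?w ?w) (5 * n + 4)"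
    using runs_copy_input[of "s ?h ?w ?w ?w ?e" input 5] by (simp add: s_nth s_upd)
  have "runs (forward (\<lambda>x. x \<noteq> None) 0) (s ?h ?w ?w ?w ?w)
      ((s ?h ?w ?w ?w ?w)(0 := zip_tape ([] @ input) [])) (2 * length input + 1)"
    by (rule runs_forward) (simp_all add: s_nth)
  then have 5: "runs (forward (\<lambda>x. x \<noteq> None) 0) (s ?h ?w ?w ?w ?w) (s ?w ?w ?w ?w ?w) (2 * n + 1)"
    by (simp add: s_upd)
  have 6: "runs (home 2) (s ?w ?w ?w ?w ?w) (s ?w ?h ?w ?w ?w) (2 * n + 3)"
    using runs_home[of "s ?w ?w ?w ?w ?w" 2 input "[]" n] by (simp add: s_nth s_upd)
  have 7: "runs (home 3 ;; next_list 3) (s ?w ?h ?w ?w ?w) (s ?w ?h (right_tape [] rs) ?w ?w)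
      (4 * n + 3)"
    using runs_home_right[of "s ?w ?h ?w ?w ?w" 3 input "[]"] by (simp add: s_nth s_upd)
  have 8: "runs (home 4 ;; next_list 4 ;; next_list 4) (s ?w ?h (right_tape [] rs) ?w ?w)
      (s ?w ?h (right_tape [] rs) eqs_tape ?w) (6 * n + 3)"
    using runs_home_eqs[of "s ?w ?h (right_tape [] rs) ?w ?w" 4 input "[]"] by (simp add: s_nth s_upd)
  have 9: "runs (home 5) (s ?w ?h (right_tape [] rs) eqs_tape ?w)
      (s ?w ?h (right_tape [] rs) eqs_tape ?h) (2 * n + 3)"
    using runs_home[of "s ?w ?h (right_tape [] rs) eqs_tape ?w" 5 input "[]" n]
    by (simp add: s_nth s_upd)
  show ?thesis
    unfolding start final[symmetric] machine_init_def
    by (rule runs_mono[OF runs_Seq[OF 1 runs_Seq[OF 2 runs_Seq[OF 3 runs_Seq[OF 4 runs_Seq[OF 5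
        runs_Seq[OF 6 runs_Seq[OF 7 runs_Seq[OF 8 9]]]]]]]]]) simp
qed

definition solver_output :: "letter list" where
  "solver_output = enc_vars (numbered (\<lambda>_. True) n pairs) @ concat (map table_entry (ls @ rs))"

lemma runs_solver:
  "\<exists>tx. runs solver (\<lambda>j. (word_on_tape (if j = 0 then input else []), 0))
    (state solver_output tx 0) (solver_time n)"
proof -
  let ?tx = "zip_tape [] input"
  let ?o1 = "enc_words (numbered (\<lambda>_. True) n pairs)"
  let ?o2 = "enc_vars (numbered (\<lambda>_. True) n pairs)"
  let ?o3 = "?o2 @ concat (map table_entry ls)"
  let ?tx1 = "zip_tape ([] @ enc_vars ls) (enc_vars rs @ enc_eqs es)"
  let ?tx2 = "zip_tape (([] @ enc_vars ls) @ enc_vars rs) (enc_eqs es)"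
  have 1: "runs (all_pairs every_body) (state [] ?tx 0) (state ?o1 ?tx (length pairs))
      (all_pairs_time (1 + emit_time n) n)"
    using runs_all_pairs[OF pair_body_every, of "[]" ?tx] by (simp add: state_def)
  have 2: "runs (append_symbol 1 Semicolon) (state ?o1 ?tx 0) (state ?o2 ?tx 0) 1"
    by (rule runs_Do) (simp add: enc_vars_eq)
  have "runs entries (state ?o2 (zip_tape [] (enc_vars ls @ (enc_vars rs @ enc_eqs es))) 0)
      (state ?o3 ?tx1 0) (entries_time n)"
    by (rule runs_entries) (simp_all add: length_enc_words_ls)
  then have 3: "runs entries (state ?o2 ?tx 0) (state ?o3 ?tx1 0) (entries_time n)"
    by (simp only: flip: input_def)
  have 4: "runs entries (state ?o3 ?tx1 0) (state (?o3 @ concat (map table_entry rs)) ?tx2 0)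
      (entries_time n)"
    by (rule runs_entries) (use stops_enc_vars[of "[]" ls] in \<open>simp_all add: length_enc_words_rs\<close>)
  have "runs solver (\<lambda>j. (word_on_tape (if j = 0 then input else []), 0))
      (state (?o3 @ concat (map table_entry rs)) ?tx2 0) (solver_time n)"
    unfolding solver_def solver_time_def
    by (rule runs_Seq[OF runs_machine_init runs_Seq[OF 1 runs_Seq[OF runs_erase_counter
        runs_Seq[OF 2 runs_Seq[OF 3 4]]]]])
  moreover have "?o3 @ concat (map table_entry rs) = solver_output"
    by (simp add: solver_output_def)
  ultimately show ?thesis by (intro exI[of _ ?tx2]) (simp only:)
qed

lemma computes_output: "computes_within (compile 10 solver) input solver_output (solver_time n)"
proof -
  obtain tx where "runs solver (\<lambda>j. (word_on_tape (if j = 0 then input else []), 0))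
      (state solver_output tx 0) (solver_time n)"
    using runs_solver by blast
  then show ?thesis
    by (rule computes_within_compile) (simp_all add: tapes_below_solver zip_tape_def)
qed

definition fresh_var :: "nat \<Rightarrow> var" where
  "fresh_var k = replicate (n + k) True"

text \<open>Repetitions in \<open>ls\<close> and \<open>rs\<close> cause repeated table entries and
  several names for one pair. The encoding admits the former, since repeated entries agree, and
  \<open>symbolic_solution_pairs\<close> the latter.\<close>

lemma encodes_output:
  assumes L: "left_vars \<Sigma> = set ls" and R: "right_vars \<Sigma> = set rs"
    and E: "equations \<Sigma> = set_eqs es" and wf: "wf_system \<Sigma>"
  shows "\<exists>V g. encodes_symbolic_valuation \<Sigma> solver_output V g \<and> symbolic_solution U \<Sigma> V g"
proof -
  let ?V = "set (numbered (\<lambda>_. True) n pairs)"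
  let ?g = "\<lambda>x. set (numbered (selects x) n pairs)"
  have "encodes_symbolic_valuation \<Sigma> solver_output ?V ?g"
    unfolding encodes_symbolic_valuation_def
    by (intro exI[of _ "numbered (\<lambda>_. True) n pairs"]
        exI[of _ "map (\<lambda>x. (x, numbered (selects x) n pairs)) (ls @ rs)"])
      (auto simp: solver_output_def table_entry_def[abs_def] L R comp_def image_Un image_image)
  moreover have "symbolic_solution U \<Sigma> ?V ?g"
  proof (rule symbolic_solution_pairs[OF wf, where ps = pairs and nm = fresh_var])
    show "set pairs = cell_pairs \<Sigma>"
      by (simp add: cell_pairs_def L R)
    show "inj_on fresh_var {..<length pairs}"
      by (rule inj_onI) (simp add: fresh_var_def)
    \<comment> \<open>In the input each variable is followed by a comma, so it is strictly shorter
      than the input, while new names have length at least \<open>n\<close>.\<close>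
    have "length x < n" if "x \<in> set ls \<union> set rs" for x
      using that length_enc_words_member[of x ls] length_enc_words_member[of x rs]
      by (auto simp: input_def enc_vars_eq enc_var_def)
    moreover have "n \<le> length (fresh_var k)" for k
      by (simp add: fresh_var_def)
    ultimately have "fresh_var k \<notin> set ls \<union> set rs" for k
      by (metis leD)
    then show "fresh_var ` {..<length pairs} \<inter> (left_vars \<Sigma> \<union> right_vars \<Sigma>) = {}"
      unfolding L R by blast
    show "?V = fresh_var ` {..<length pairs}"
      by (simp add: set_numbered fresh_var_def[abs_def] lessThan_def)
    show "?g x = fresh_var ` {k. k < length pairs \<and> compatible (equations \<Sigma>) (pairs ! k) \<and>
        (Some x = fst (pairs ! k) \<or> Some x = snd (pairs ! k))}" for x
      unfolding set_numbered fresh_var_def[abs_def] E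
      by (rule arg_cong[where f = "image _"]) blast
  qed
  ultimately show ?thesis by blast
qed

end

section \<open>Polynomial time bound and conclusion\<close>

text \<open>Evaluation at \<open>n\<close> is a semiring homomorphism, so it commutes with each time
  function; \<open>[:0, 1:]\<close> is the indeterminate. The auxiliary facts hold for arbitrary
  polynomial arguments because the time functions are nested.\<close>

lemma poly_solver_time: "poly (solver_time [:0, 1:]) n = (solver_time n :: nat)"
proof -
  have member: "poly (member_time p) n = member_time (poly p n)" for p :: "nat poly"
    by (simp add: member_time_def)
  have check: "poly (check_eqs_time p) n = check_eqs_time (poly p n)" for p :: "nat poly"
    by (simp add: check_eqs_time_def member)
  have emit: "poly (emit_time p) n = emit_time (poly p n)" for p :: "nat poly"
    by (simp add: emit_time_def)
  have each: "poly (each_time t p) n = each_time (poly t n) (poly p n)" for t p :: "nat poly"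
    by (simp add: each_time_def)
  have all: "poly (all_pairs_time t p) n = all_pairs_time (poly t n) (poly p n)"
    for t p :: "nat poly"
    by (simp add: all_pairs_time_def each)
  have select: "poly (select_time p) n = select_time (poly p n)" for p :: "nat poly"
    by (simp add: select_time_def check emit)
  have entry: "poly (entry_time p) n = entry_time (poly p n)" for p :: "nat poly"
    by (simp add: entry_time_def all select)
  have entries: "poly (entries_time p) n = entries_time (poly p n)" for p :: "nat poly"
    by (simp add: entries_time_def entry)
  have "poly (solver_time p) n = solver_time (poly p n)" for p :: "nat poly"
    by (simp add: solver_time_def all emit entries)
  then show ?thesis by simp
qed

theorem theorem2:
  fixes U :: "'u set"
  assumes "infinite (UNIV :: 'v set)"
  shows "(\<forall>\<Sigma> :: 'v system. wf_system \<Sigma> \<longrightarrow> (\<exists>V g. symbolic_solution U \<Sigma> V g)) \<and>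
    (\<exists>(M :: letter tm) (p :: nat poly). wf_tm M \<and>
      (\<forall>(\<Sigma> :: var system) w. wf_system \<Sigma> \<longrightarrow> encodes_system w \<Sigma> \<longrightarrow>
        (\<exists>v V g. computes_within M w v (poly p (length w)) \<and>
          encodes_symbolic_valuation \<Sigma> v V g \<and> symbolic_solution U \<Sigma> V g)))"
proof (intro conjI allI impI exI[of _ "compile 10 solver"] exI[of _ "solver_time [:0, 1:]"])
  show "\<exists>V g. symbolic_solution U \<Sigma> V g" if "wf_system \<Sigma>" for \<Sigma> :: "'v system"
    using assms that by (rule symbolic_solution_exists)
  show "wf_tm (compile 10 solver)"
    by (rule wf_compile) simp
  fix \<Sigma> :: "var system" and w
  assume wf: "wf_system \<Sigma>" and "encodes_system w \<Sigma>"
  then obtain ls rs es where w: "w = enc_vars ls @ enc_vars rs @ enc_eqs es"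
    and \<Sigma>: "left_vars \<Sigma> = set ls" "right_vars \<Sigma> = set rs" "equations \<Sigma> = set_eqs es"
    unfolding encodes_system_def enc_eqs_def set_eqs_def by blast
  have input: "system_code.input ls rs es = w"
    by (simp add: w system_code.input_def)
  obtain V g where "encodes_symbolic_valuation \<Sigma> (system_code.solver_output ls rs es) V g"
    "symbolic_solution U \<Sigma> V g"
    using system_code.encodes_output[OF \<Sigma> wf] by blast
  then show "\<exists>v V g. computes_within (compile 10 solver) w v (poly (solver_time [:0, 1:]) (length w)) \<and>
      encodes_symbolic_valuation \<Sigma> v V g \<and> symbolic_solution U \<Sigma> V g"
    using system_code.computes_output[of ls rs es] unfolding poly_solver_time input by blast
qed

end
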